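(* Let $E$ and $F$ be two objects of $\mathcal{T}c$. If $E$ is bornological and $F$ is complete, then $$\mathrm{Hom}_{\mathrm{Ind}(\mathcal{B}an)}(\mathrm{IB}(E),\mathrm{IB}(F))\simeq\mathrm{Hom}_{\mathcal{T}c}(E,F).$$
   Context: $\mathcal{T}c$ is the category of complex locally convex topological vector spaces (not necessarily Hausdorff) and continuous linear maps; "complete" includes Hausdorff. $E$ is bornological if any absolutely convex subset of $E$ that absorbs every bounded subset is a neighborhood of zero. $\mathcal{B}an$ is the category of complex Banach spaces and continuous linear maps; $\mathrm{Ind}(\mathcal{B}an)$ is its category of ind-objects (formal filtered inductive limits $``\varinjlim"_iE_i$ with $\mathrm{Hom}(``\varinjlim"_iE_i,``\varinjlim"_jF_j)=\varprojlim_i\varinjlim_j\mathrm{Hom}(E_i,F_j)$). For $E$ in $\mathcal{T}c$, $\mathrm{IB}(E)=``\varinjlim"_B\widehat{E}_B$, where $B$ runs over the absolutely convex bounded subsets of $E$ (ordered by inclusion), $E_B$ is the linear hull of $B$ with the gauge semi-norm of $B$, and $\widehat{E}_B$ its completion; a continuous linear map $f:E\to F$ induces $\mathrm{IB}(f):\mathrm{IB}(E)\to\mathrm{IB}(F)$ via the maps $\widehat{E}_B\to\widehat{F}_{f(B)}$. *)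

theory Defs
  imports "HOL-Analysis.Analysis"
begin

section \<open>Locally convex spaces\<close>

text \<open>
  Complex topological vector spaces are given by a type in the class
  \<^class>\<open>topological_ab_group_add\<close> (which does not include the Hausdorff axiom)
  together with a scalar multiplication.  A set \<open>U\<close> is a neighbourhood of zero if it
  contains an open set around zero; it need not be open.
\<close>

definition nhd0 :: "'a::topological_ab_group_add set \<Rightarrow> bool"
  where "nhd0 U \<longleftrightarrow> (\<forall>\<^sub>F x in nhds 0. x \<in> U)"

definition convex_over :: "(complex \<Rightarrow> 'a::ab_group_add \<Rightarrow> 'a) \<Rightarrow> 'a set \<Rightarrow> bool"
  where "convex_over sc V \<longleftrightarrow>
    (\<forall>x\<in>V. \<forall>y\<in>V. \<forall>u\<ge>0. \<forall>v\<ge>0. u + v = (1::real) \<longrightarrow>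
      sc (of_real u) x + sc (of_real v) y \<in> V)"

locale complex_vector_space = vector_space sc
  for sc :: "complex \<Rightarrow> 'a::ab_group_add \<Rightarrow> 'a"

locale lctvs = complex_vector_space sc
  for sc :: "complex \<Rightarrow> 'a::topological_ab_group_add \<Rightarrow> 'a" +
  assumes continuous_scale: "continuous_on UNIV (\<lambda>(c, x). sc c x)"
    and locally_convex: "\<And>U. nhd0 U \<Longrightarrow> \<exists>V\<subseteq>U. nhd0 V \<and> convex_over sc V"

text \<open>
  Absolutely convex sets are non-empty by convention, so that they contain zero and their
  gauge is finite on their linear hull.
\<close>

definition abs_convex :: "(complex \<Rightarrow> 'a::ab_group_add \<Rightarrow> 'a) \<Rightarrow> 'a set \<Rightarrow> bool"
  where "abs_convex sc B \<longleftrightarrow> B \<noteq> {} \<and>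
    (\<forall>x\<in>B. \<forall>y\<in>B. \<forall>a b. cmod a + cmod b \<le> 1 \<longrightarrow> sc a x + sc b y \<in> B)"

definition absorbs :: "(complex \<Rightarrow> 'a \<Rightarrow> 'a) \<Rightarrow> 'a set \<Rightarrow> 'a set \<Rightarrow> bool"
  where "absorbs sc U B \<longleftrightarrow> (\<exists>r>0. \<forall>c. r \<le> cmod c \<longrightarrow> B \<subseteq> sc c ` U)"

definition tvs_bounded :: "(complex \<Rightarrow> 'a::topological_ab_group_add \<Rightarrow> 'a) \<Rightarrow> 'a set \<Rightarrow> bool"
  where "tvs_bounded sc B \<longleftrightarrow> (\<forall>U. nhd0 U \<longrightarrow> absorbs sc U B)"

definition bornological :: "(complex \<Rightarrow> 'a::topological_ab_group_add \<Rightarrow> 'a) \<Rightarrow> bool"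
  where "bornological sc \<longleftrightarrow>
    (\<forall>A. abs_convex sc A \<and> (\<forall>B. tvs_bounded sc B \<longrightarrow> absorbs sc A B) \<longrightarrow> nhd0 A)"

text \<open>
  The translation-invariant uniformity is generated by the sets of pairs \<open>(x, y)\<close> with
  \<open>x - y\<close> in a given neighbourhood of zero.  Completeness is Hausdorffness together with
  convergence of all Cauchy filters, as in \<^const>\<open>complete\<close>, which is not available here as
  it requires the class \<^class>\<open>uniform_space\<close>.
\<close>

definition tvs_uniformity :: "('a::topological_ab_group_add \<times> 'a) filter"
  where "tvs_uniformity = filtercomap (\<lambda>(x, y). x - y) (nhds 0)"

definition tvs_complete :: "'a::topological_ab_group_add itself \<Rightarrow> bool"
  where "tvs_complete TYPE('a) \<longleftrightarrow>
    Hausdorff_space (euclidean :: 'a topology) \<and>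
    (\<forall>F :: 'a filter. F \<noteq> bot \<longrightarrow> F \<times>\<^sub>F F \<le> tvs_uniformity \<longrightarrow> (\<exists>x. F \<le> nhds x))"

definition tc_hom ::
    "(complex \<Rightarrow> 'a::topological_ab_group_add \<Rightarrow> 'a) \<Rightarrow>
     (complex \<Rightarrow> 'b::topological_ab_group_add \<Rightarrow> 'b) \<Rightarrow> ('a \<Rightarrow> 'b) set"
  where "tc_hom sE sF = {f. Vector_Spaces.linear sE sF f \<and> continuous_on UNIV f}"


section \<open>Semi-normed spaces, Banach spaces and completions\<close>

text \<open>
  The Banach spaces needed below are parametrised by sets, so they are represented with
  explicit carriers rather than by types of class \<^class>\<open>banach\<close>.
\<close>

record 'a seminormed =
  vcarrier :: "'a set"
  vadd :: "'a \<Rightarrow> 'a \<Rightarrow> 'a"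
  vzero :: 'a
  vscale :: "complex \<Rightarrow> 'a \<Rightarrow> 'a"
  vnorm :: "'a \<Rightarrow> real"

definition vdist :: "'a seminormed \<Rightarrow> 'a \<Rightarrow> 'a \<Rightarrow> real"
  where "vdist V x y = vnorm V (vadd V x (vscale V (-1) y))"

definition cauchy_seqs :: "'a seminormed \<Rightarrow> (nat \<Rightarrow> 'a) set"
  where "cauchy_seqs V = {x. (\<forall>n. x n \<in> vcarrier V) \<and>
    (\<forall>e>0. \<exists>N. \<forall>m\<ge>N. \<forall>n\<ge>N. vdist V (x m) (x n) < e)}"

locale seminormed_space =
  fixes V :: "'a seminormed"
  assumes add_closed: "\<lbrakk>x \<in> vcarrier V; y \<in> vcarrier V\<rbrakk> \<Longrightarrow> vadd V x y \<in> vcarrier V"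
    and zero_closed: "vzero V \<in> vcarrier V"
    and scale_closed: "x \<in> vcarrier V \<Longrightarrow> vscale V c x \<in> vcarrier V"
    and add_assoc: "\<lbrakk>x \<in> vcarrier V; y \<in> vcarrier V; z \<in> vcarrier V\<rbrakk> \<Longrightarrow>
      vadd V (vadd V x y) z = vadd V x (vadd V y z)"
    and add_commute: "\<lbrakk>x \<in> vcarrier V; y \<in> vcarrier V\<rbrakk> \<Longrightarrow> vadd V x y = vadd V y x"
    and add_zero: "x \<in> vcarrier V \<Longrightarrow> vadd V x (vzero V) = x"
    and add_inverse: "x \<in> vcarrier V \<Longrightarrow> \<exists>y\<in>vcarrier V. vadd V x y = vzero V"
    and scale_add_right: "\<lbrakk>x \<in> vcarrier V; y \<in> vcarrier V\<rbrakk> \<Longrightarrow>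
      vscale V c (vadd V x y) = vadd V (vscale V c x) (vscale V c y)"
    and scale_add_left: "x \<in> vcarrier V \<Longrightarrow>
      vscale V (c + d) x = vadd V (vscale V c x) (vscale V d x)"
    and scale_scale: "x \<in> vcarrier V \<Longrightarrow> vscale V c (vscale V d x) = vscale V (c * d) x"
    and scale_one: "x \<in> vcarrier V \<Longrightarrow> vscale V 1 x = x"
    and norm_nonneg: "x \<in> vcarrier V \<Longrightarrow> 0 \<le> vnorm V x"
    and norm_triangle: "\<lbrakk>x \<in> vcarrier V; y \<in> vcarrier V\<rbrakk> \<Longrightarrow>
      vnorm V (vadd V x y) \<le> vnorm V x + vnorm V y"
    and norm_scale: "x \<in> vcarrier V \<Longrightarrow> vnorm V (vscale V c x) = cmod c * vnorm V x"

locale banach_space = seminormed_space V for V :: "'a seminormed" +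
  assumes norm_eq_zero: "\<lbrakk>x \<in> vcarrier V; vnorm V x = 0\<rbrakk> \<Longrightarrow> x = vzero V"
    and norm_complete: "s \<in> cauchy_seqs V \<Longrightarrow>
      \<exists>l\<in>vcarrier V. (\<lambda>n. vdist V (s n) l) \<longlonglongrightarrow> 0"

text \<open>
  Morphisms are functions that are \<^const>\<open>undefined\<close> outside the carrier, so that equality of
  morphisms is equality of functions; composition is \<^const>\<open>compose\<close>.
\<close>

definition ban_hom :: "'a seminormed \<Rightarrow> 'b seminormed \<Rightarrow> ('a \<Rightarrow> 'b) set"
  where "ban_hom V W = {f \<in> vcarrier V \<rightarrow>\<^sub>E vcarrier W.
    (\<forall>x\<in>vcarrier V. \<forall>y\<in>vcarrier V. f (vadd V x y) = vadd W (f x) (f y)) \<and>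
    (\<forall>c. \<forall>x\<in>vcarrier V. f (vscale V c x) = vscale W c (f x)) \<and>
    (\<forall>x\<in>vcarrier V. \<forall>e>0. \<exists>d>0. \<forall>y\<in>vcarrier V. vdist V y x < d \<longrightarrow> vdist W (f y) (f x) < e)}"

text \<open>
  The (Hausdorff) completion: Cauchy sequences modulo sequences converging to zero, with the
  operations acting on representatives.
\<close>

definition null_rel :: "'a seminormed \<Rightarrow> ((nat \<Rightarrow> 'a) \<times> (nat \<Rightarrow> 'a)) set"
  where "null_rel V = {(x, y). x \<in> cauchy_seqs V \<and> y \<in> cauchy_seqs V \<and>
    (\<lambda>n. vdist V (x n) (y n)) \<longlonglongrightarrow> 0}"

definition hcompletion :: "'a seminormed \<Rightarrow> (nat \<Rightarrow> 'a) set seminormed"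
  where "hcompletion V = \<lparr>
    vcarrier = cauchy_seqs V // null_rel V,
    vadd = (\<lambda>X Y. \<Union>x\<in>X. \<Union>y\<in>Y. null_rel V `` {\<lambda>n. vadd V (x n) (y n)}),
    vzero = null_rel V `` {\<lambda>n. vzero V},
    vscale = (\<lambda>c X. \<Union>x\<in>X. null_rel V `` {\<lambda>n. vscale V c (x n)}),
    vnorm = (\<lambda>X. THE l. \<forall>x\<in>X. (\<lambda>n. vnorm V (x n)) \<longlonglongrightarrow> l)\<rparr>"

definition completion_map ::
    "'a seminormed \<Rightarrow> 'b seminormed \<Rightarrow> ('a \<Rightarrow> 'b) \<Rightarrow> (nat \<Rightarrow> 'a) set \<Rightarrow> (nat \<Rightarrow> 'b) set"
  where "completion_map V W f =
    (\<lambda>X\<in>vcarrier (hcompletion V). \<Union>x\<in>X. null_rel W `` {\<lambda>n. f (x n)})"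


section \<open>Ind-objects in Banach spaces\<close>

text \<open>
  Formal inductive limits of Banach spaces indexed by a directed (pre-)ordered set, which
  is the only kind of filtered index category needed for \<open>IB\<close> below.
\<close>

record ('i, 'a) ind_object =
  idx :: "'i set"
  leq :: "'i \<Rightarrow> 'i \<Rightarrow> bool"
  obj :: "'i \<Rightarrow> 'a seminormed"
  trans_map :: "'i \<Rightarrow> 'i \<Rightarrow> 'a \<Rightarrow> 'a"

locale ind_banach =
  fixes X :: "('i, 'a) ind_object"
  assumes idx_nonempty: "idx X \<noteq> {}"
    and leq_refl: "i \<in> idx X \<Longrightarrow> leq X i i"
    and leq_trans: "\<lbrakk>i \<in> idx X; j \<in> idx X; k \<in> idx X; leq X i j; leq X j k\<rbrakk> \<Longrightarrow> leq X i k"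
    and directed: "\<lbrakk>i \<in> idx X; j \<in> idx X\<rbrakk> \<Longrightarrow> \<exists>k\<in>idx X. leq X i k \<and> leq X j k"
    and obj_banach: "i \<in> idx X \<Longrightarrow> banach_space (obj X i)"
    and trans_hom: "\<lbrakk>i \<in> idx X; j \<in> idx X; leq X i j\<rbrakk> \<Longrightarrow>
      trans_map X i j \<in> ban_hom (obj X i) (obj X j)"
    and trans_id: "i \<in> idx X \<Longrightarrow> trans_map X i i = restrict id (vcarrier (obj X i))"
    and trans_comp: "\<lbrakk>i \<in> idx X; j \<in> idx X; k \<in> idx X; leq X i j; leq X j k\<rbrakk> \<Longrightarrow>
      compose (vcarrier (obj X i)) (trans_map X j k) (trans_map X i j) = trans_map X i k"

text \<open>
  \<open>colim_hom V Y\<close> is the inductive limit over \<open>j\<close> of the sets of morphisms from \<open>V\<close> to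
  \<open>obj Y j\<close>: pairs \<open>(j, u)\<close>, two of which are identified when they become equal at a common
  larger index.
\<close>

definition colim_rel ::
    "'a seminormed \<Rightarrow> ('j, 'b) ind_object \<Rightarrow> (('j \<times> ('a \<Rightarrow> 'b)) \<times> ('j \<times> ('a \<Rightarrow> 'b))) set"
  where "colim_rel V Y = {((j, u), (j', u')).
    j \<in> idx Y \<and> u \<in> ban_hom V (obj Y j) \<and> j' \<in> idx Y \<and> u' \<in> ban_hom V (obj Y j') \<and>
    (\<exists>k\<in>idx Y. leq Y j k \<and> leq Y j' k \<and>
      compose (vcarrier V) (trans_map Y j k) u = compose (vcarrier V) (trans_map Y j' k) u')}"

definition colim_hom :: "'a seminormed \<Rightarrow> ('j, 'b) ind_object \<Rightarrow> ('j \<times> ('a \<Rightarrow> 'b)) set set"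
  where "colim_hom V Y = (SIGMA j:idx Y. ban_hom V (obj Y j)) // colim_rel V Y"

definition colim_add :: "'a seminormed \<Rightarrow> ('j, 'b) ind_object \<Rightarrow>
    ('j \<times> ('a \<Rightarrow> 'b)) set \<Rightarrow> ('j \<times> ('a \<Rightarrow> 'b)) set \<Rightarrow> ('j \<times> ('a \<Rightarrow> 'b)) set"
  where "colim_add V Y c d = (\<Union>(j, u)\<in>c. \<Union>(j', u')\<in>d. \<Union>k\<in>{k \<in> idx Y. leq Y j k \<and> leq Y j' k}.
    colim_rel V Y `` {(k, \<lambda>x\<in>vcarrier V.
      vadd (obj Y k) (trans_map Y j k (u x)) (trans_map Y j' k (u' x)))})"

definition colim_scale :: "'a seminormed \<Rightarrow> ('j, 'b) ind_object \<Rightarrow>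
    complex \<Rightarrow> ('j \<times> ('a \<Rightarrow> 'b)) set \<Rightarrow> ('j \<times> ('a \<Rightarrow> 'b)) set"
  where "colim_scale V Y a c = (\<Union>(j, u)\<in>c.
    colim_rel V Y `` {(j, \<lambda>x\<in>vcarrier V. vscale (obj Y j) a (u x))})"

text \<open>Precomposition with a morphism \<open>t\<close> from \<open>V\<close>.\<close>

definition colim_precomp :: "'a seminormed \<Rightarrow> ('j, 'b) ind_object \<Rightarrow>
    ('a \<Rightarrow> 'c) \<Rightarrow> ('j \<times> ('c \<Rightarrow> 'b)) set \<Rightarrow> ('j \<times> ('a \<Rightarrow> 'b)) set"
  where "colim_precomp V Y t c =
    (\<Union>(j, u)\<in>c. colim_rel V Y `` {(j, compose (vcarrier V) u t)})"

text \<open>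
  The projective limit over \<open>i\<close> of \<open>colim_hom (obj X i) Y\<close>, with its complex vector space
  structure.
\<close>

definition ind_hom :: "('i, 'a) ind_object \<Rightarrow> ('j, 'b) ind_object \<Rightarrow>
    ('i \<Rightarrow> ('j \<times> ('a \<Rightarrow> 'b)) set) set"
  where "ind_hom X Y = {\<phi> \<in> (\<Pi>\<^sub>E i\<in>idx X. colim_hom (obj X i) Y).
    \<forall>i\<in>idx X. \<forall>i'\<in>idx X. leq X i i' \<longrightarrow>
      \<phi> i = colim_precomp (obj X i) Y (trans_map X i i') (\<phi> i')}"

definition ind_hom_add :: "('i, 'a) ind_object \<Rightarrow> ('j, 'b) ind_object \<Rightarrow>
    ('i \<Rightarrow> ('j \<times> ('a \<Rightarrow> 'b)) set) \<Rightarrow> ('i \<Rightarrow> ('j \<times> ('a \<Rightarrow> 'b)) set) \<Rightarrow>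
    'i \<Rightarrow> ('j \<times> ('a \<Rightarrow> 'b)) set"
  where "ind_hom_add X Y \<phi> \<psi> = (\<lambda>i\<in>idx X. colim_add (obj X i) Y (\<phi> i) (\<psi> i))"

definition ind_hom_scale :: "('i, 'a) ind_object \<Rightarrow> ('j, 'b) ind_object \<Rightarrow>
    complex \<Rightarrow> ('i \<Rightarrow> ('j \<times> ('a \<Rightarrow> 'b)) set) \<Rightarrow> 'i \<Rightarrow> ('j \<times> ('a \<Rightarrow> 'b)) set"
  where "ind_hom_scale X Y a \<phi> = (\<lambda>i\<in>idx X. colim_scale (obj X i) Y a (\<phi> i))"


section \<open>The functor IB\<close>

definition gauge_seminorm :: "(complex \<Rightarrow> 'a \<Rightarrow> 'a) \<Rightarrow> 'a set \<Rightarrow> 'a \<Rightarrow> real"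
  where "gauge_seminorm sc B x = Inf {t. 0 < t \<and> x \<in> sc (of_real t) ` B}"

definition hull_space ::
    "(complex \<Rightarrow> 'a::ab_group_add \<Rightarrow> 'a) \<Rightarrow> 'a set \<Rightarrow> 'a seminormed"
  where "hull_space sc B = \<lparr>
    vcarrier = module.span sc B,
    vadd = (+),
    vzero = 0,
    vscale = sc,
    vnorm = gauge_seminorm sc B\<rparr>"

text \<open>The transition maps are induced by the inclusions of linear hulls.\<close>

definition IB :: "(complex \<Rightarrow> 'a::topological_ab_group_add \<Rightarrow> 'a) \<Rightarrow>
    ('a set, (nat \<Rightarrow> 'a) set) ind_object"
  where "IB sc = \<lparr>
    idx = {B. abs_convex sc B \<and> tvs_bounded sc B},
    leq = (\<subseteq>),
    obj = (\<lambda>B. hcompletion (hull_space sc B)),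
    trans_map = (\<lambda>B B'. completion_map (hull_space sc B) (hull_space sc B') id)\<rparr>"

definition IB_map ::
    "(complex \<Rightarrow> 'a::topological_ab_group_add \<Rightarrow> 'a) \<Rightarrow>
     (complex \<Rightarrow> 'b::topological_ab_group_add \<Rightarrow> 'b) \<Rightarrow> ('a \<Rightarrow> 'b) \<Rightarrow>
     'a set \<Rightarrow> ('b set \<times> ((nat \<Rightarrow> 'a) set \<Rightarrow> (nat \<Rightarrow> 'b) set)) set"
  where "IB_map sE sF f = (\<lambda>B\<in>idx (IB sE).
    colim_rel (obj (IB sE) B) (IB sF) ``
      {(f ` B, completion_map (hull_space sE B) (hull_space sF (f ` B)) f)})"


section \<open>Well-definedness: IB takes values in ind-objects of Banach spaces\<close>

context seminormed_space
begin

abbreviation "neg x \<equiv> vscale V (-1) x"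

lemma scale_zero: assumes "x \<in> vcarrier V" shows "vscale V 0 x = vzero V"
proof -
  let ?z = "vscale V 0 x"
  have z: "?z \<in> vcarrier V" using assms by (rule scale_closed)
  obtain y where y: "y \<in> vcarrier V" "vadd V ?z y = vzero V" using add_inverse[OF z] by blast
  have "vadd V ?z ?z = ?z" using scale_add_left[OF assms, of 0 0] by simp
  then have "vadd V (vadd V ?z ?z) y = vadd V ?z y" by simp
  then show ?thesis using add_assoc[OF z z y(1)] y add_zero[OF z] by simp
qed

lemma add_neg: assumes "x \<in> vcarrier V" shows "vadd V x (neg x) = vzero V"
  using scale_add_left[OF assms, of 1 "-1"] scale_zero[OF assms] scale_one[OF assms] by simp

lemma zero_add: "x \<in> vcarrier V \<Longrightarrow> vadd V (vzero V) x = x"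
  using add_commute[OF zero_closed] add_zero by metis

lemma norm_zero: "vnorm V (vzero V) = 0"
  using norm_scale[OF zero_closed, of 0] scale_zero[OF zero_closed] by simp

lemma scale_vzero: "vscale V c (vzero V) = vzero V"
  using scale_scale[OF zero_closed, of c 0] scale_zero[OF zero_closed] by simp

lemma dist_nonneg: "\<lbrakk>x \<in> vcarrier V; y \<in> vcarrier V\<rbrakk> \<Longrightarrow> 0 \<le> vdist V x y"
  unfolding vdist_def by (intro norm_nonneg add_closed scale_closed)

lemma dist_self: "x \<in> vcarrier V \<Longrightarrow> vdist V x x = 0"
  unfolding vdist_def by (simp add: add_neg norm_zero)

lemma dist_zero: "x \<in> vcarrier V \<Longrightarrow> vdist V x (vzero V) = vnorm V x"
  unfolding vdist_def by (simp add: scale_vzero add_zero)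

lemma add_left_commute:
  "\<lbrakk>x \<in> vcarrier V; y \<in> vcarrier V; z \<in> vcarrier V\<rbrakk> \<Longrightarrow>
    vadd V x (vadd V y z) = vadd V y (vadd V x z)"
  by (metis add_assoc add_commute)

lemma dist_triangle:
  assumes x: "x \<in> vcarrier V" and y: "y \<in> vcarrier V" and z: "z \<in> vcarrier V"
  shows "vdist V x z \<le> vdist V x y + vdist V y z"
proof -
  have ny: "neg y \<in> vcarrier V" and nz: "neg z \<in> vcarrier V" using y z by (auto intro: scale_closed)
  have "vadd V (vadd V x (neg y)) (vadd V y (neg z)) = vadd V x (vadd V (neg y) (vadd V y (neg z)))"
    using x y ny nz by (simp add: add_assoc add_closed)
  also have "vadd V (neg y) (vadd V y (neg z)) = vadd V (vadd V y (neg y)) (neg z)"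
    using y ny nz by (metis add_assoc add_commute)
  also have "\<dots> = neg z" using y nz by (simp add: add_neg zero_add)
  finally show ?thesis unfolding vdist_def
    using norm_triangle[OF add_closed[OF x ny] add_closed[OF y nz]] by simp
qed

lemma dist_commute:
  assumes x: "x \<in> vcarrier V" and y: "y \<in> vcarrier V"
  shows "vdist V x y = vdist V y x"
proof -
  have "neg (vadd V x (neg y)) = vadd V y (neg x)"
    using x y by (simp add: scale_add_right scale_closed scale_scale scale_one add_commute)
  then show ?thesis unfolding vdist_def
    using norm_scale[OF add_closed[OF x scale_closed[OF y]], of "-1" "-1"] by simp
qed

lemma norm_diff_le_dist:
  assumes x: "x \<in> vcarrier V" and y: "y \<in> vcarrier V"
  shows "\<bar>vnorm V x - vnorm V y\<bar> \<le> vdist V x y"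
  using dist_triangle[OF x y zero_closed] dist_triangle[OF y x zero_closed] dist_commute[OF x y]
  by (simp add: dist_zero x y)

lemma dist_add:
  assumes "x \<in> vcarrier V" "y \<in> vcarrier V" "x' \<in> vcarrier V" "y' \<in> vcarrier V"
  shows "vdist V (vadd V x y) (vadd V x' y') \<le> vdist V x x' + vdist V y y'"
proof -
  have n: "neg x' \<in> vcarrier V" "neg y' \<in> vcarrier V" using assms by (auto intro: scale_closed)
  have "vadd V (vadd V x y) (neg (vadd V x' y')) = vadd V (vadd V x (neg x')) (vadd V y (neg y'))"
    using assms n by (simp add: scale_add_right add_assoc add_left_commute add_closed)
  then show ?thesis unfolding vdist_def using assms n by (simp add: norm_triangle add_closed)
qed

lemma dist_scale:
  assumes x: "x \<in> vcarrier V" and y: "y \<in> vcarrier V"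
  shows "vdist V (vscale V c x) (vscale V c y) = cmod c * vdist V x y"
proof -
  have "vadd V (vscale V c x) (neg (vscale V c y)) = vscale V c (vadd V x (neg y))"
    using x y by (simp add: scale_add_right scale_closed scale_scale)
  then show ?thesis unfolding vdist_def using x y by (simp add: norm_scale add_closed scale_closed)
qed

lemma cauchy_closed: "x \<in> cauchy_seqs V \<Longrightarrow> x n \<in> vcarrier V"
  by (simp add: cauchy_seqs_def)

lemma cauchyE:
  assumes "x \<in> cauchy_seqs V" "0 < e"
  obtains N where "\<And>m n. \<lbrakk>N \<le> m; N \<le> n\<rbrakk> \<Longrightarrow> vdist V (x m) (x n) < e"
  using assms unfolding cauchy_seqs_def by blast

lemma cauchy_add:
  assumes x: "x \<in> cauchy_seqs V" and y: "y \<in> cauchy_seqs V"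
  shows "(\<lambda>n. vadd V (x n) (y n)) \<in> cauchy_seqs V"
  unfolding cauchy_seqs_def
proof (intro CollectI conjI allI impI)
  show "vadd V (x n) (y n) \<in> vcarrier V" for n
    using x y by (intro add_closed cauchy_closed)
  fix e :: real assume "0 < e"
  then have e: "0 < e/2" by simp
  obtain M where M: "\<And>m n. \<lbrakk>M \<le> m; M \<le> n\<rbrakk> \<Longrightarrow> vdist V (x m) (x n) < e/2" by (rule cauchyE[OF x e]) blast
  obtain N where N: "\<And>m n. \<lbrakk>N \<le> m; N \<le> n\<rbrakk> \<Longrightarrow> vdist V (y m) (y n) < e/2" by (rule cauchyE[OF y e]) blast
  show "\<exists>N. \<forall>m\<ge>N. \<forall>n\<ge>N. vdist V (vadd V (x m) (y m)) (vadd V (x n) (y n)) < e"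
  proof (intro exI allI impI)
    fix m n assume mn: "max M N \<le> m" "max M N \<le> n"
    have "vdist V (vadd V (x m) (y m)) (vadd V (x n) (y n)) \<le> vdist V (x m) (x n) + vdist V (y m) (y n)"
      using x y by (intro dist_add cauchy_closed)
    then show "vdist V (vadd V (x m) (y m)) (vadd V (x n) (y n)) < e"
      using M[of m n] N[of m n] mn by simp
  qed
qed

lemma cauchy_scale:
  assumes x: "x \<in> cauchy_seqs V"
  shows "(\<lambda>n. vscale V c (x n)) \<in> cauchy_seqs V"
  unfolding cauchy_seqs_def
proof (intro CollectI conjI allI impI)
  show "vscale V c (x n) \<in> vcarrier V" for n
    using x by (intro scale_closed cauchy_closed)
  fix e :: real assume "0 < e"
  then have e: "0 < e/(cmod c + 1)" by (simp add: add_nonneg_pos)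
  obtain M where M: "\<And>m n. \<lbrakk>M \<le> m; M \<le> n\<rbrakk> \<Longrightarrow> vdist V (x m) (x n) < e/(cmod c + 1)"
    by (rule cauchyE[OF x e]) blast
  show "\<exists>N. \<forall>m\<ge>N. \<forall>n\<ge>N. vdist V (vscale V c (x m)) (vscale V c (x n)) < e"
  proof (intro exI allI impI)
    fix m n assume mn: "M \<le> m" "M \<le> n"
    have "vdist V (vscale V c (x m)) (vscale V c (x n)) = cmod c * vdist V (x m) (x n)"
      using x by (intro dist_scale cauchy_closed)
    also have "\<dots> \<le> (cmod c + 1) * vdist V (x m) (x n)"
      by (intro mult_right_mono dist_nonneg cauchy_closed x) simp
    also have "\<dots> < e" using M[OF mn] by (simp add: pos_less_divide_eq add_nonneg_pos mult.commute)
    finally show "vdist V (vscale V c (x m)) (vscale V c (x n)) < e" .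
  qed
qed

lemma cauchy_const: "a \<in> vcarrier V \<Longrightarrow> (\<lambda>n. a) \<in> cauchy_seqs V"
  by (simp add: cauchy_seqs_def dist_self)

lemma cauchy_norm_convergent:
  assumes x: "x \<in> cauchy_seqs V"
  obtains l where "(\<lambda>n. vnorm V (x n)) \<longlonglongrightarrow> l"
proof -
  have "Cauchy (\<lambda>n. vnorm V (x n))"
  proof (rule metric_CauchyI)
    fix e :: real assume "0 < e"
    then obtain N where N: "\<And>m n. \<lbrakk>N \<le> m; N \<le> n\<rbrakk> \<Longrightarrow> vdist V (x m) (x n) < e" using cauchyE[OF x] by blast
    have "dist (vnorm V (x m)) (vnorm V (x n)) < e" if "N \<le> m" "N \<le> n" for m n
      using N[OF that] norm_diff_le_dist[of "x m" "x n"] x by (simp add: dist_real_def cauchy_closed)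
    then show "\<exists>N. \<forall>m\<ge>N. \<forall>n\<ge>N. dist (vnorm V (x m)) (vnorm V (x n)) < e" by blast
  qed
  then show ?thesis using that by (meson Cauchy_convergent_iff convergent_def)
qed

lemma null_relD: "(x, y) \<in> null_rel V \<Longrightarrow> x \<in> cauchy_seqs V \<and> y \<in> cauchy_seqs V"
  by (simp add: null_rel_def)

lemma null_relI:
  assumes "x \<in> cauchy_seqs V" "y \<in> cauchy_seqs V" "(\<lambda>n. vdist V (x n) (y n)) \<longlonglongrightarrow> 0"
  shows "(x, y) \<in> null_rel V"
  using assms by (simp add: null_rel_def)

lemma null_rel_le:
  assumes "x \<in> cauchy_seqs V" "y \<in> cauchy_seqs V" "g \<longlonglongrightarrow> 0" "\<And>n. vdist V (x n) (y n) \<le> g n"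
  shows "(x, y) \<in> null_rel V"
proof (rule null_relI)
  show "(\<lambda>n. vdist V (x n) (y n)) \<longlonglongrightarrow> 0"
    by (rule tendsto_sandwich[OF _ _ tendsto_const assms(3)])
      (use assms in \<open>auto intro!: always_eventually dist_nonneg cauchy_closed\<close>)
qed (use assms in auto)

lemma equiv_null_rel: "equiv (cauchy_seqs V) (null_rel V)"
proof (rule equivI)
  show "refl_on (cauchy_seqs V) (null_rel V)"
    by (rule refl_onI) (simp add: null_rel_def dist_self cauchy_closed)
  show "null_rel V \<subseteq> cauchy_seqs V \<times> cauchy_seqs V" by (auto dest: null_relD)
  show "sym (null_rel V)"
    by (rule symI) (auto simp: null_rel_def dist_commute cauchy_closed)
  show "trans (null_rel V)"
  proof (rule transI)
    fix x y z assume "(x, y) \<in> null_rel V" "(y, z) \<in> null_rel V"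
    then have *: "x \<in> cauchy_seqs V" "y \<in> cauchy_seqs V" "z \<in> cauchy_seqs V"
      "(\<lambda>n. vdist V (x n) (y n)) \<longlonglongrightarrow> 0" "(\<lambda>n. vdist V (y n) (z n)) \<longlonglongrightarrow> 0"
      by (auto simp: null_rel_def)
    show "(x, z) \<in> null_rel V"
      by (rule null_rel_le[OF *(1,3) tendsto_add_zero[OF *(4,5)]])
        (use * in \<open>auto intro: dist_triangle cauchy_closed\<close>)
  qed
qed

definition cls :: "(nat \<Rightarrow> 'a) \<Rightarrow> (nat \<Rightarrow> 'a) set" where "cls x = null_rel V `` {x}"

lemma cls_eq: "(x, y) \<in> null_rel V \<Longrightarrow> cls x = cls y"
  unfolding cls_def by (rule equiv_class_eq[OF equiv_null_rel])

lemma in_cls: "x \<in> cauchy_seqs V \<Longrightarrow> x \<in> cls x"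
  unfolding cls_def by (rule equiv_class_self[OF equiv_null_rel])

lemma in_clsD: "y \<in> cls x \<Longrightarrow> (x, y) \<in> null_rel V"
  by (simp add: cls_def)

lemma cls_eq_iff: "\<lbrakk>x \<in> cauchy_seqs V; y \<in> cauchy_seqs V\<rbrakk> \<Longrightarrow> cls x = cls y \<longleftrightarrow> (x, y) \<in> null_rel V"
  unfolding cls_def by (rule eq_equiv_class_iff[OF equiv_null_rel])

lemma carrier_completion: "vcarrier (hcompletion V) = cls ` cauchy_seqs V"
  by (auto simp: hcompletion_def quotient_def cls_def)

lemma carrier_completionE:
  assumes "X \<in> vcarrier (hcompletion V)"
  obtains x where "x \<in> cauchy_seqs V" "X = cls x"
  using assms by (auto simp: carrier_completion)

lemma UN_cls:
  assumes "x \<in> cauchy_seqs V" "\<And>x'. (x, x') \<in> null_rel V \<Longrightarrow> h x' = h x"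
  shows "(\<Union>x'\<in>cls x. h x') = h x"
  using assms(2) in_clsD by (intro UN_constant_eq[OF in_cls[OF assms(1)]]) simp

lemma add_null_rel:
  assumes "(x, x') \<in> null_rel V" "(y, y') \<in> null_rel V"
  shows "((\<lambda>n. vadd V (x n) (y n)), (\<lambda>n. vadd V (x' n) (y' n))) \<in> null_rel V"
proof -
  have *: "x \<in> cauchy_seqs V" "y \<in> cauchy_seqs V" "x' \<in> cauchy_seqs V" "y' \<in> cauchy_seqs V"
    "(\<lambda>n. vdist V (x n) (x' n)) \<longlonglongrightarrow> 0" "(\<lambda>n. vdist V (y n) (y' n)) \<longlonglongrightarrow> 0"
    using assms by (auto simp: null_rel_def)
  show ?thesis
    by (rule null_rel_le[OF cauchy_add cauchy_add tendsto_add_zero[OF *(5,6)]])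
      (use * in \<open>auto intro: dist_add cauchy_closed\<close>)
qed

lemma scale_null_rel:
  assumes "(x, x') \<in> null_rel V"
  shows "((\<lambda>n. vscale V c (x n)), (\<lambda>n. vscale V c (x' n))) \<in> null_rel V"
proof -
  have *: "x \<in> cauchy_seqs V" "x' \<in> cauchy_seqs V" "(\<lambda>n. vdist V (x n) (x' n)) \<longlonglongrightarrow> 0"
    using assms by (auto simp: null_rel_def)
  show ?thesis
    by (rule null_rel_le[OF cauchy_scale cauchy_scale tendsto_mult_right_zero[OF *(3), of "cmod c"]])
      (use * in \<open>auto simp: dist_scale cauchy_closed\<close>)
qed

lemma completion_add:
  assumes "x \<in> cauchy_seqs V" "y \<in> cauchy_seqs V"
  shows "vadd (hcompletion V) (cls x) (cls y) = cls (\<lambda>n. vadd V (x n) (y n))"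
proof -
  have refl: "(z, z) \<in> null_rel V" if "z \<in> cauchy_seqs V" for z
    using that equiv_null_rel by (meson equivE refl_onD)
  have "vadd (hcompletion V) (cls x) (cls y) = (\<Union>x'\<in>cls x. \<Union>y'\<in>cls y. cls (\<lambda>n. vadd V (x' n) (y' n)))"
    by (simp add: hcompletion_def cls_def)
  also have "\<dots> = (\<Union>y'\<in>cls y. cls (\<lambda>n. vadd V (x n) (y' n)))"
  proof (rule UN_cls[OF assms(1)])
    fix x' assume "(x, x') \<in> null_rel V"
    then have "cls (\<lambda>n. vadd V (x' n) (y' n)) = cls (\<lambda>n. vadd V (x n) (y' n))" if "y' \<in> cls y" for y'
      by (rule cls_eq[OF add_null_rel[OF _ refl[OF conjunct2[OF null_relD[OF in_clsD[OF that]]]]], symmetric])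
    then show "(\<Union>y'\<in>cls y. cls (\<lambda>n. vadd V (x' n) (y' n))) = (\<Union>y'\<in>cls y. cls (\<lambda>n. vadd V (x n) (y' n)))"
      by simp
  qed
  also have "\<dots> = cls (\<lambda>n. vadd V (x n) (y n))"
    by (rule UN_cls[OF assms(2)]) (rule cls_eq[OF add_null_rel[OF refl[OF assms(1)]], symmetric])
  finally show ?thesis .
qed

lemma completion_scale:
  assumes "x \<in> cauchy_seqs V"
  shows "vscale (hcompletion V) c (cls x) = cls (\<lambda>n. vscale V c (x n))"
proof -
  have "vscale (hcompletion V) c (cls x) = (\<Union>x'\<in>cls x. cls (\<lambda>n. vscale V c (x' n)))"
    by (simp add: hcompletion_def cls_def)
  also have "\<dots> = cls (\<lambda>n. vscale V c (x n))"
    by (rule UN_cls[OF assms]) (rule cls_eq[OF scale_null_rel, symmetric])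
  finally show ?thesis .
qed

lemma completion_zero: "vzero (hcompletion V) = cls (\<lambda>n. vzero V)"
  by (simp add: hcompletion_def cls_def)

lemma completion_norm:
  assumes x: "x \<in> cauchy_seqs V" and l: "(\<lambda>n. vnorm V (x n)) \<longlonglongrightarrow> l"
  shows "vnorm (hcompletion V) (cls x) = l"
proof -
  have *: "(\<lambda>n. vnorm V (x' n)) \<longlonglongrightarrow> l" if "x' \<in> cls x" for x'
  proof -
    have r: "x' \<in> cauchy_seqs V" "(\<lambda>n. vdist V (x n) (x' n)) \<longlonglongrightarrow> 0"
      using in_clsD[OF that] by (auto simp: null_rel_def)
    have "(\<lambda>n. vnorm V (x' n) - vnorm V (x n)) \<longlonglongrightarrow> 0"
      by (rule Lim_null_comparison[OF _ r(2)])
        (use norm_diff_le_dist x r(1) in \<open>auto simp: cauchy_closed abs_minus_commute intro!: always_eventually\<close>)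
    from tendsto_add[OF this l] show ?thesis by simp
  qed
  have "(THE l. \<forall>x'\<in>cls x. (\<lambda>n. vnorm V (x' n)) \<longlonglongrightarrow> l) = l"
    using * in_cls[OF x] by (intro the_equality) (auto intro: LIMSEQ_unique)
  then show ?thesis by (simp add: hcompletion_def)
qed

lemma completion_norm_lim:
  assumes x: "x \<in> cauchy_seqs V"
  shows "(\<lambda>n. vnorm V (x n)) \<longlonglongrightarrow> vnorm (hcompletion V) (cls x)"
  using cauchy_norm_convergent[OF x] completion_norm[OF x] by metis

lemma cls_closed: "x \<in> cauchy_seqs V \<Longrightarrow> cls x \<in> vcarrier (hcompletion V)"
  by (simp add: carrier_completion)

lemma cauchy_diff:
  "\<lbrakk>x \<in> cauchy_seqs V; y \<in> cauchy_seqs V\<rbrakk> \<Longrightarrow> (\<lambda>n. vadd V (x n) (neg (y n))) \<in> cauchy_seqs V"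
  by (intro cauchy_add cauchy_scale)

lemma completion_dist_lim:
  assumes x: "x \<in> cauchy_seqs V" and y: "y \<in> cauchy_seqs V"
  shows "(\<lambda>n. vdist V (x n) (y n)) \<longlonglongrightarrow> vdist (hcompletion V) (cls x) (cls y)"
  using completion_norm_lim[OF cauchy_diff[OF x y]]
  by (simp add: vdist_def completion_scale completion_add cauchy_scale x y)

theorem seminormed_completion: "seminormed_space (hcompletion V)"
proof
  fix x y z c d
  assume "x \<in> vcarrier (hcompletion V)" then obtain s where s: "s \<in> cauchy_seqs V" "x = cls s"
    by (rule carrier_completionE)
  show "vscale (hcompletion V) c x \<in> vcarrier (hcompletion V)"
    using s by (simp add: completion_scale cls_closed cauchy_scale)
  show "vadd (hcompletion V) x (vzero (hcompletion V)) = x"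
    using s by (simp add: completion_zero completion_add cauchy_const zero_closed add_zero cauchy_closed)
  show "\<exists>y\<in>vcarrier (hcompletion V). vadd (hcompletion V) x y = vzero (hcompletion V)"
    using s by (intro bexI[of _ "cls (\<lambda>n. neg (s n))"])
      (simp_all add: completion_zero completion_add cauchy_scale add_neg cauchy_closed cls_closed)
  show "vscale (hcompletion V) (c + d) x
      = vadd (hcompletion V) (vscale (hcompletion V) c x) (vscale (hcompletion V) d x)"
    using s by (simp add: completion_scale completion_add cauchy_scale scale_add_left cauchy_closed)
  show "vscale (hcompletion V) c (vscale (hcompletion V) d x) = vscale (hcompletion V) (c * d) x"
    using s by (simp add: completion_scale cauchy_scale scale_scale cauchy_closed)
  show "vscale (hcompletion V) 1 x = x"
    using s by (simp add: completion_scale scale_one cauchy_closed)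
  show "0 \<le> vnorm (hcompletion V) x"
    using s completion_norm_lim[OF s(1)] by (auto intro!: LIMSEQ_le_const norm_nonneg cauchy_closed)
  show "vnorm (hcompletion V) (vscale (hcompletion V) c x) = cmod c * vnorm (hcompletion V) x"
  proof -
    have "(\<lambda>n. vnorm V (vscale V c (s n))) \<longlonglongrightarrow> cmod c * vnorm (hcompletion V) (cls s)"
      using tendsto_mult_left[OF completion_norm_lim[OF s(1)], of "cmod c"] s(1)
      by (simp add: norm_scale cauchy_closed)
    then show ?thesis using s by (simp add: completion_scale completion_norm cauchy_scale)
  qed
  assume "y \<in> vcarrier (hcompletion V)" then obtain t where t: "t \<in> cauchy_seqs V" "y = cls t"
    by (rule carrier_completionE)
  show "vadd (hcompletion V) x y \<in> vcarrier (hcompletion V)"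
    using s t by (simp add: completion_add cls_closed cauchy_add)
  show "vadd (hcompletion V) x y = vadd (hcompletion V) y x"
    using s t by (simp add: completion_add add_commute cauchy_closed)
  show "vscale (hcompletion V) c (vadd (hcompletion V) x y)
      = vadd (hcompletion V) (vscale (hcompletion V) c x) (vscale (hcompletion V) c y)"
    using s t by (simp add: completion_scale completion_add cauchy_scale cauchy_add scale_add_right cauchy_closed)
  show "vnorm (hcompletion V) (vadd (hcompletion V) x y) \<le> vnorm (hcompletion V) x + vnorm (hcompletion V) y"
    using LIMSEQ_le[OF completion_norm_lim[OF cauchy_add[OF s(1) t(1)]]
        tendsto_add[OF completion_norm_lim[OF s(1)] completion_norm_lim[OF t(1)]]]
      s t by (auto simp: completion_add norm_triangle cauchy_closed)
  assume "z \<in> vcarrier (hcompletion V)" then obtain r where r: "r \<in> cauchy_seqs V" "z = cls r"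
    by (rule carrier_completionE)
  show "vadd (hcompletion V) (vadd (hcompletion V) x y) z
      = vadd (hcompletion V) x (vadd (hcompletion V) y z)"
    using s t r by (simp add: completion_add cauchy_add add_assoc cauchy_closed)
qed (simp add: completion_zero cls_closed cauchy_const zero_closed)

theorem banach_completion: "banach_space (hcompletion V)"
proof -
  interpret comp: seminormed_space "hcompletion V" by (rule seminormed_completion)
  show ?thesis
  proof
    fix X assume X: "X \<in> vcarrier (hcompletion V)" "vnorm (hcompletion V) X = 0"
    then obtain s where s: "s \<in> cauchy_seqs V" "X = cls s" by (auto elim: carrier_completionE)
    have "(s, \<lambda>n. vzero V) \<in> null_rel V"
      using completion_norm_lim[OF s(1)] X(2) s
      by (intro null_relI) (auto simp: cauchy_const zero_closed dist_zero cauchy_closed)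
    then show "X = vzero (hcompletion V)" using s cls_eq by (simp add: completion_zero)
  next
    fix X assume X: "X \<in> cauchy_seqs (hcompletion V)"
    have "\<exists>s. \<forall>n. s n \<in> cauchy_seqs V \<and> X n = cls (s n)"
    proof (rule choice, rule allI)
      fix n
      show "\<exists>t. t \<in> cauchy_seqs V \<and> X n = cls t"
        using comp.cauchy_closed[OF X, of n] by (rule carrier_completionE) blast
    qed
    then obtain s where s: "\<And>n. s n \<in> cauchy_seqs V" "\<And>n. X n = cls (s n)" by blast
    have sc: "s n k \<in> vcarrier V" for n k using s(1) by (rule cauchy_closed)
    have "\<exists>N. \<forall>n. \<forall>k\<ge>N n. \<forall>l\<ge>N n. vdist V (s n k) (s n l) < 1 / real (Suc n)"
    proof (rule choice, rule allI)
      fix n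
      have "0 < 1 / real (Suc n)" by simp
      from cauchyE[OF s(1) this] show "\<exists>M. \<forall>k\<ge>M. \<forall>l\<ge>M. vdist V (s n k) (s n l) < 1 / real (Suc n)"
        by metis
    qed
    then obtain N where N: "\<And>n k l. \<lbrakk>N n \<le> k; N n \<le> l\<rbrakk> \<Longrightarrow> vdist V (s n k) (s n l) < 1 / real (Suc n)"
      by blast
    define y where "y n = s n (N n)" for n
    have yc: "y n \<in> vcarrier V" for n by (simp add: y_def sc)
    have yd: "vdist V (y n) (y m) \<le> 1 / real (Suc n) + vdist (hcompletion V) (X n) (X m) + 1 / real (Suc m)" for n m
    proof -
      have lim: "(\<lambda>k. 1 / real (Suc n) + vdist V (s n k) (s m k) + 1 / real (Suc m))
          \<longlonglongrightarrow> 1 / real (Suc n) + vdist (hcompletion V) (X n) (X m) + 1 / real (Suc m)"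
        unfolding s(2) by (intro tendsto_intros completion_dist_lim s(1))
      show ?thesis
      proof (rule LIMSEQ_le_const[OF lim], intro exI allI impI)
        fix k assume k: "max (N n) (N m) \<le> k"
        have "vdist V (y n) (y m) \<le> vdist V (y n) (s n k) + vdist V (s n k) (y m)"
          by (intro dist_triangle yc sc)
        also have "\<dots> \<le> vdist V (y n) (s n k) + (vdist V (s n k) (s m k) + vdist V (s m k) (y m))"
          by (intro add_left_mono dist_triangle yc sc)
        finally show "vdist V (y n) (y m) \<le> 1 / real (Suc n) + vdist V (s n k) (s m k) + 1 / real (Suc m)"
          using N[of n "N n" k] N[of m k "N m"] k by (simp add: y_def)
      qed
    qed
    have small: "\<exists>M. \<forall>n\<ge>M. 1 / real (Suc n) < e" if "0 < e" for e
      using LIMSEQ_inverse_real_of_nat that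
      by (auto simp: LIMSEQ_def dist_real_def inverse_eq_divide)
    have y: "y \<in> cauchy_seqs V"
      unfolding cauchy_seqs_def
    proof (intro CollectI conjI allI impI yc)
      fix e :: real assume "0 < e"
      then have e: "0 < e/3" by simp
      obtain M where M: "\<And>m n. \<lbrakk>M \<le> m; M \<le> n\<rbrakk> \<Longrightarrow> vdist (hcompletion V) (X m) (X n) < e/3"
        by (rule comp.cauchyE[OF X e]) blast
      obtain K where K: "\<And>n. K \<le> n \<Longrightarrow> 1 / real (Suc n) < e/3" using small[OF e] by blast
      show "\<exists>N. \<forall>m\<ge>N. \<forall>n\<ge>N. vdist V (y m) (y n) < e"
      proof (intro exI allI impI)
        fix m n assume "max M K \<le> m" "max M K \<le> n"
        then show "vdist V (y m) (y n) < e" using yd[of m n] M[of m n] K[of m] K[of n] by simp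
      qed
    qed
    have "(\<lambda>n. vdist (hcompletion V) (X n) (cls y)) \<longlonglongrightarrow> 0"
    proof (rule LIMSEQ_I)
      fix e :: real assume "0 < e"
      then have e: "0 < e/3" by simp
      obtain M where M: "\<And>m n. \<lbrakk>M \<le> m; M \<le> n\<rbrakk> \<Longrightarrow> vdist V (y m) (y n) < e/3" by (rule cauchyE[OF y e]) blast
      obtain K where K: "\<And>n. K \<le> n \<Longrightarrow> 1 / real (Suc n) < e/3" using small[OF e] by blast
      have "norm (vdist (hcompletion V) (X n) (cls y) - 0) < e" if n: "max M K \<le> n" for n
      proof -
        have "vdist (hcompletion V) (X n) (cls y) \<le> e/3 + e/3"
          unfolding s(2)
        proof (rule LIMSEQ_le_const2[OF completion_dist_lim[OF s(1) y]], intro exI allI impI)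
          fix k assume k: "max (N n) M \<le> k"
          have "vdist V (s n k) (y k) \<le> vdist V (s n k) (y n) + vdist V (y n) (y k)"
            by (intro dist_triangle yc sc)
          then show "vdist V (s n k) (y k) \<le> e/3 + e/3"
            using N[of n k "N n"] M[of n k] K[of n] n k by (simp add: y_def)
        qed
        moreover have "0 \<le> vdist (hcompletion V) (X n) (cls y)"
          by (intro comp.dist_nonneg comp.cauchy_closed[OF X] cls_closed[OF y])
        ultimately show ?thesis using \<open>0 < e\<close> by simp
      qed
      then show "\<exists>no. \<forall>n\<ge>no. norm (vdist (hcompletion V) (X n) (cls y) - 0) < e" by blast
    qed
    then show "\<exists>l\<in>vcarrier (hcompletion V). (\<lambda>n. vdist (hcompletion V) (X n) l) \<longlonglongrightarrow> 0"
      using cls_closed[OF y] by blast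
  qed
qed

end


locale seminormed_hom = V: seminormed_space V + W: seminormed_space W
  for V :: "'a seminormed" and W :: "'b seminormed" +
  fixes f :: "'a \<Rightarrow> 'b" and K :: real
  assumes closed: "x \<in> vcarrier V \<Longrightarrow> f x \<in> vcarrier W"
    and hom_add: "\<lbrakk>x \<in> vcarrier V; y \<in> vcarrier V\<rbrakk> \<Longrightarrow> f (vadd V x y) = vadd W (f x) (f y)"
    and hom_scale: "x \<in> vcarrier V \<Longrightarrow> f (vscale V c x) = vscale W c (f x)"
    and pos: "0 < K"
    and norm_le: "x \<in> vcarrier V \<Longrightarrow> vnorm W (f x) \<le> K * vnorm V x"
begin

lemma dist_le:
  assumes "x \<in> vcarrier V" "y \<in> vcarrier V"
  shows "vdist W (f x) (f y) \<le> K * vdist V x y"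
  using norm_le[OF V.add_closed[OF assms(1) V.scale_closed[OF assms(2), of "-1"]]] assms
  by (simp add: vdist_def hom_add hom_scale V.scale_closed)

lemma restrict_hom: "restrict f (vcarrier V) \<in> ban_hom V W"
proof -
  have "\<exists>d>0. \<forall>y\<in>vcarrier V. vdist V y x < d \<longrightarrow> vdist W (f y) (f x) < e"
    if "x \<in> vcarrier V" "0 < e" for x and e :: real
  proof (intro exI conjI ballI impI)
    show "0 < e / K" using that pos by simp
    fix y assume y: "y \<in> vcarrier V" "vdist V y x < e / K"
    then have "K * vdist V y x < e" using pos by (simp add: field_simps)
    then show "vdist W (f y) (f x) < e" using dist_le[OF y(1) that(1)] by simp
  qed
  then show ?thesis
    by (simp add: ban_hom_def closed hom_add hom_scale V.add_closed V.scale_closed)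
qed

lemma cauchy_image:
  assumes s: "s \<in> cauchy_seqs V"
  shows "(\<lambda>n. f (s n)) \<in> cauchy_seqs W"
  unfolding cauchy_seqs_def
proof (intro CollectI conjI allI impI)
  show "f (s n) \<in> vcarrier W" for n using s by (intro closed V.cauchy_closed)
  fix e :: real assume "0 < e"
  then have e: "0 < e / K" using pos by simp
  obtain N where N: "\<And>m n. \<lbrakk>N \<le> m; N \<le> n\<rbrakk> \<Longrightarrow> vdist V (s m) (s n) < e / K"
    by (rule V.cauchyE[OF s e]) blast
  show "\<exists>N. \<forall>m\<ge>N. \<forall>n\<ge>N. vdist W (f (s m)) (f (s n)) < e"
  proof (intro exI allI impI)
    fix m n assume "N \<le> m" "N \<le> n"
    then have "K * vdist V (s m) (s n) < e" using N[of m n] pos by (simp add: field_simps)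
    then show "vdist W (f (s m)) (f (s n)) < e"
      using dist_le[of "s m" "s n"] V.cauchy_closed[OF s] by simp
  qed
qed

lemma null_rel_image:
  assumes "(s, t) \<in> null_rel V"
  shows "((\<lambda>n. f (s n)), (\<lambda>n. f (t n))) \<in> null_rel W"
proof -
  have *: "s \<in> cauchy_seqs V" "t \<in> cauchy_seqs V" "(\<lambda>n. vdist V (s n) (t n)) \<longlonglongrightarrow> 0"
    using assms by (auto simp: null_rel_def)
  show ?thesis
    by (rule W.null_rel_le[OF cauchy_image cauchy_image tendsto_mult_right_zero[OF *(3), of K]])
      (use * in \<open>auto intro: dist_le V.cauchy_closed\<close>)
qed

lemma completion_map_cls:
  assumes "s \<in> cauchy_seqs V"
  shows "completion_map V W f (V.cls s) = W.cls (\<lambda>n. f (s n))"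
proof -
  have "completion_map V W f (V.cls s) = (\<Union>t\<in>V.cls s. W.cls (\<lambda>n. f (t n)))"
    by (simp add: completion_map_def W.cls_def V.cls_closed assms)
  also have "\<dots> = W.cls (\<lambda>n. f (s n))"
    by (rule V.UN_cls[OF assms]) (rule W.cls_eq[OF null_rel_image, symmetric])
  finally show ?thesis .
qed

lemma completion_map_hom: "completion_map V W f \<in> ban_hom (hcompletion V) (hcompletion W)"
proof -
  interpret c: seminormed_hom "hcompletion V" "hcompletion W" "completion_map V W f" K
  proof (intro seminormed_hom.intro V.seminormed_completion W.seminormed_completion
      seminormed_hom_axioms.intro pos)
    fix X Y c
    assume "X \<in> vcarrier (hcompletion V)"
    then obtain s where s: "s \<in> cauchy_seqs V" "X = V.cls s" by (rule V.carrier_completionE)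
    show "completion_map V W f X \<in> vcarrier (hcompletion W)"
      using s by (simp add: completion_map_cls W.cls_closed cauchy_image)
    show "completion_map V W f (vscale (hcompletion V) c X) = vscale (hcompletion W) c (completion_map V W f X)"
      using s by (simp add: completion_map_cls V.completion_scale W.completion_scale cauchy_image
          V.cauchy_scale hom_scale V.cauchy_closed)
    show "vnorm (hcompletion W) (completion_map V W f X) \<le> K * vnorm (hcompletion V) X"
      using LIMSEQ_le[OF W.completion_norm_lim[OF cauchy_image[OF s(1)]]
          tendsto_mult_left[OF V.completion_norm_lim[OF s(1)], of K]] s
      by (auto simp: completion_map_cls norm_le V.cauchy_closed)
    assume "Y \<in> vcarrier (hcompletion V)"
    then obtain t where t: "t \<in> cauchy_seqs V" "Y = V.cls t" by (rule V.carrier_completionE)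
    show "completion_map V W f (vadd (hcompletion V) X Y) =
        vadd (hcompletion W) (completion_map V W f X) (completion_map V W f Y)"
      using s t by (simp add: completion_map_cls V.completion_add W.completion_add cauchy_image
          V.cauchy_add hom_add V.cauchy_closed)
  qed
  have "restrict (completion_map V W f) (vcarrier (hcompletion V)) = completion_map V W f"
    by (simp add: completion_map_def)
  then show ?thesis using c.restrict_hom by simp
qed

end

context complex_vector_space
begin

context
  fixes B assumes B: "abs_convex sc B"
begin

lemma abs_convexD: "\<lbrakk>x \<in> B; y \<in> B; cmod a + cmod b \<le> 1\<rbrakk> \<Longrightarrow> sc a x + sc b y \<in> B"
  using B by (simp add: abs_convex_def)

lemma abs_convex_scale: "\<lbrakk>x \<in> B; cmod a \<le> 1\<rbrakk> \<Longrightarrow> sc a x \<in> B"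
  using abs_convexD[of x x a 0] by simp

lemma zero_in_abs_convex: "0 \<in> B"
  using B abs_convex_scale[of _ 0] by (auto simp: abs_convex_def)

abbreviation "dil t \<equiv> sc (of_real t) ` B"

lemma dil_mono:
  assumes "0 < s" "s \<le> t" "x \<in> dil s" shows "x \<in> dil t"
proof -
  obtain b where b: "x = sc (of_real s) b" "b \<in> B" using assms(3) by (rule imageE)
  have "cmod (of_real (s / t)) \<le> 1" using assms(1,2) by (simp del: of_real_divide)
  with b(2) have "sc (of_real (s / t)) b \<in> B" by (rule abs_convex_scale)
  moreover have "x = sc (of_real t) (sc (of_real (s / t)) b)" using b(1) assms(1,2) by simp
  ultimately show ?thesis by (rule rev_image_eqI)
qed

lemma dil_add:
  assumes "0 < s" "0 < t" "x \<in> dil s" "y \<in> dil t" shows "x + y \<in> dil (s + t)"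
proof -
  obtain b where b: "x = sc (of_real s) b" "b \<in> B" using assms(3) by (rule imageE)
  obtain c where c: "y = sc (of_real t) c" "c \<in> B" using assms(4) by (rule imageE)
  have "cmod (of_real (s / (s+t))) + cmod (of_real (t / (s+t))) \<le> 1"
    using assms(1,2) by (simp del: of_real_divide add: add_divide_distrib[symmetric])
  with b(2) c(2) have "sc (of_real (s / (s+t))) b + sc (of_real (t / (s+t))) c \<in> B"
    by (rule abs_convexD)
  moreover have "complex_of_real s + complex_of_real t \<noteq> 0"
    using assms(1,2) by (simp flip: of_real_add)
  then have "x + y = sc (of_real (s+t)) (sc (of_real (s / (s+t))) b + sc (of_real (t / (s+t))) c)"
    using b(1) c(1) by (simp add: scale_right_distrib)
  ultimately show ?thesis by (rule rev_image_eqI)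
qed

lemma dil_scale:
  assumes "c \<noteq> 0" "x \<in> dil t" shows "sc c x \<in> dil (cmod c * t)"
proof -
  obtain b where b: "x = sc (of_real t) b" "b \<in> B" using assms(2) by (rule imageE)
  have "cmod (c / of_real (cmod c)) \<le> 1" using assms(1) by (simp add: norm_divide)
  with b(2) have "sc (c / of_real (cmod c)) b \<in> B" by (rule abs_convex_scale)
  moreover have "sc c x = sc (of_real (cmod c * t)) (sc (c / of_real (cmod c)) b)"
    using b(1) assms(1) by (simp add: mult.commute)
  ultimately show ?thesis by (rule rev_image_eqI)
qed

lemma span_abs_convex: "span B = {x. \<exists>t>0. x \<in> dil t}" (is "_ = ?S")
proof
  have SI: "x \<in> ?S" if "0 < t" "x \<in> dil t" for x t
    using that by (intro CollectI exI[of _ t] conjI)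
  have SE: "\<exists>t. 0 < t \<and> x \<in> dil t" if "x \<in> ?S" for x
    using that by simp
  have "subspace ?S"
  proof (rule subspaceI)
    have "0 = sc (of_real 1) 0" by simp
    then have "0 \<in> dil 1" using zero_in_abs_convex by (rule image_eqI)
    then show zero: "0 \<in> ?S" by (rule SI[OF zero_less_one])
    show "x + y \<in> ?S" if xy: "x \<in> ?S" "y \<in> ?S" for x y
    proof -
      obtain s where "0 < s" "x \<in> dil s" using SE[OF xy(1)] by (elim exE conjE)
      moreover obtain t where "0 < t" "y \<in> dil t" using SE[OF xy(2)] by (elim exE conjE)
      ultimately show ?thesis using SI[of "s + t" "x + y"] dil_add[of s t x y] by simp
    qed
    show "sc c x \<in> ?S" if x: "x \<in> ?S" for c x
    proof (cases "c = 0")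
      case True then show ?thesis using zero by simp
    next
      case False
      obtain s where "0 < s" "x \<in> dil s" using SE[OF x] by (elim exE conjE)
      then show ?thesis using SI[of "cmod c * s" "sc c x"] dil_scale[OF False, of x s] False by simp
    qed
  qed
  moreover have "B \<subseteq> ?S"
  proof
    fix x assume x: "x \<in> B"
    have "x = sc (of_real 1) x" by simp
    then have "x \<in> dil 1" using x by (rule image_eqI)
    then show "x \<in> ?S" by (rule SI[OF zero_less_one])
  qed
  ultimately show "span B \<subseteq> ?S" by (intro span_minimal)
  show "?S \<subseteq> span B"
  proof
    fix x assume "x \<in> ?S"
    from SE[OF this] obtain t where "x \<in> dil t" by (elim exE conjE)
    then obtain b where "b \<in> B" "x = sc (of_real t) b" by (rule imageE)
    then show "x \<in> span B" by (simp add: span_scale span_base)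
  qed
qed

lemma span_dil: "x \<in> span B \<Longrightarrow> {t. 0 < t \<and> x \<in> dil t} \<noteq> {}"
  unfolding span_abs_convex by simp

lemma gauge_le: "\<lbrakk>0 < t; x \<in> dil t\<rbrakk> \<Longrightarrow> gauge_seminorm sc B x \<le> t"
  unfolding gauge_seminorm_def by (rule cInf_lower[OF _ bdd_belowI[of _ 0]]) simp_all

lemma gauge_nonneg: "x \<in> span B \<Longrightarrow> 0 \<le> gauge_seminorm sc B x"
  unfolding gauge_seminorm_def by (rule cInf_greatest[OF span_dil]) simp_all

lemma gauge_less:
  assumes "x \<in> span B" "gauge_seminorm sc B x < t" shows "x \<in> dil t"
proof -
  from cInf_lessD[OF span_dil[OF assms(1)] assms(2)[unfolded gauge_seminorm_def]]
  obtain s where "s \<in> {t. 0 < t \<and> x \<in> dil t}" "s < t" by (elim bexE)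
  then show ?thesis using dil_mono[of s t x] by simp
qed

lemma gauge_add:
  assumes x: "x \<in> span B" and y: "y \<in> span B"
  shows "gauge_seminorm sc B (x + y) \<le> gauge_seminorm sc B x + gauge_seminorm sc B y"
proof (rule field_le_epsilon)
  fix e :: real assume e: "0 < e"
  let ?p = "gauge_seminorm sc B"
  have p: "0 < ?p x + e/2" "0 < ?p y + e/2" using gauge_nonneg[OF x] gauge_nonneg[OF y] e by auto
  have "x + y \<in> dil ((?p x + e/2) + (?p y + e/2))"
    using e by (intro dil_add[OF p] gauge_less x y) simp_all
  then have "?p (x + y) \<le> (?p x + e/2) + (?p y + e/2)" using p by (intro gauge_le) auto
  then show "?p (x + y) \<le> ?p x + ?p y + e" by simp
qed

lemma gauge_scale_le:
  assumes x: "x \<in> span B" and c: "c \<noteq> 0"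
  shows "gauge_seminorm sc B (sc c x) \<le> cmod c * gauge_seminorm sc B x"
proof (rule field_le_epsilon)
  fix e :: real assume e: "0 < e"
  let ?p = "gauge_seminorm sc B"
  let ?t = "?p x + e / cmod c"
  have c': "0 < cmod c" using c by simp
  then have "0 < e / cmod c" using e by simp
  then have t: "0 < ?t" "?p x < ?t" using gauge_nonneg[OF x] by linarith+
  have "?p (sc c x) \<le> cmod c * ?t"
  proof (rule gauge_le)
    show "0 < cmod c * ?t" using c' t(1) by (rule mult_pos_pos)
    show "sc c x \<in> dil (cmod c * ?t)" by (rule dil_scale[OF c gauge_less[OF x t(2)]])
  qed
  also have "\<dots> = cmod c * ?p x + e" using c' by (simp add: field_simps)
  finally show "?p (sc c x) \<le> cmod c * ?p x + e" .
qed

lemma gauge_scale: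
  assumes x: "x \<in> span B"
  shows "gauge_seminorm sc B (sc c x) = cmod c * gauge_seminorm sc B x"
proof (cases "c = 0")
  case True
  have "gauge_seminorm sc B 0 \<le> 0 + e" if "0 < e" for e
    using gauge_le[OF that, of 0] zero_in_abs_convex by force
  then have "gauge_seminorm sc B 0 \<le> 0" by (rule field_le_epsilon)
  then show ?thesis using True gauge_nonneg[OF span_zero] by simp
next
  case False
  have "gauge_seminorm sc B x \<le> cmod (1/c) * gauge_seminorm sc B (sc c x)"
    using gauge_scale_le[OF span_scale[OF x], of "1/c" c] False by simp
  then have "cmod c * gauge_seminorm sc B x \<le> gauge_seminorm sc B (sc c x)"
    using False by (simp add: norm_divide field_simps)
  then show ?thesis using gauge_scale_le[OF x False] by simp
qed

lemma seminormed_hull_space: "seminormed_space (hull_space sc B)"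
proof
  fix x assume "x \<in> vcarrier (hull_space sc B)"
  then show "\<exists>y\<in>vcarrier (hull_space sc B). vadd (hull_space sc B) x y = vzero (hull_space sc B)"
    by (intro bexI[of _ "- x"]) (auto simp: hull_space_def span_neg)
qed (auto simp: hull_space_def span_add span_zero span_scale algebra_simps
    gauge_nonneg gauge_add gauge_scale)

end

lemma inclusion_hom:
  assumes B: "abs_convex sc B" and B': "abs_convex sc B'" and sub: "B \<subseteq> B'"
  shows "seminormed_hom (hull_space sc B) (hull_space sc B') id 1"
proof (intro seminormed_hom.intro seminormed_hom_axioms.intro seminormed_hull_space B B')
  fix x assume x: "x \<in> vcarrier (hull_space sc B)"
  have sp: "x \<in> span B" "x \<in> span B'" using x span_mono[OF sub] by (auto simp: hull_space_def)
  then show "id x \<in> vcarrier (hull_space sc B')" by (simp add: hull_space_def)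
  have "gauge_seminorm sc B' x \<le> gauge_seminorm sc B x"
    unfolding gauge_seminorm_def
  proof (rule cInf_superset_mono[OF span_dil[OF B sp(1)]])
    show "bdd_below {t. 0 < t \<and> x \<in> sc (complex_of_real t) ` B'}"
      by (rule bdd_belowI[of _ 0]) simp
    show "{t. 0 < t \<and> x \<in> sc (complex_of_real t) ` B} \<subseteq> {t. 0 < t \<and> x \<in> sc (complex_of_real t) ` B'}"
      using sub by (intro Collect_mono impI conjI) (simp, meson image_mono subsetD)
  qed
  then show "vnorm (hull_space sc B') (id x) \<le> 1 * vnorm (hull_space sc B) x"
    by (simp add: hull_space_def)
qed (simp_all add: hull_space_def)

end

lemma nhd0_add:
  fixes U :: "'a::topological_ab_group_add set"
  assumes "nhd0 U"
  obtains W where "nhd0 W" "\<And>x y. \<lbrakk>x \<in> W; y \<in> W\<rbrakk> \<Longrightarrow> x + y \<in> U"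
proof -
  have "((\<lambda>p. fst p + snd p) \<longlongrightarrow> 0) (nhds (0::'a) \<times>\<^sub>F nhds 0)"
    using tendsto_add_Pair[of "0::'a" 0] by (simp add: case_prod_beta')
  then have "\<forall>\<^sub>F p in nhds (0::'a) \<times>\<^sub>F nhds 0. fst p + snd p \<in> U"
    using assms unfolding nhd0_def by (rule filterlim_iff[THEN iffD1, rule_format])
  then obtain P where P: "eventually P (nhds (0::'a))" "\<And>x y. P x \<Longrightarrow> P y \<Longrightarrow> x + y \<in> U"
    unfolding eventually_prod_same by auto
  show ?thesis by (rule that[of "Collect P"]) (use P in \<open>auto simp: nhd0_def\<close>)
qed

context lctvs
begin

lemma bounded_sum:
  assumes "tvs_bounded sc B" "tvs_bounded sc C"
  shows "tvs_bounded sc {b + c | b c. b \<in> B \<and> c \<in> C}"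
  unfolding tvs_bounded_def
proof (intro allI impI)
  fix U :: "'a set" assume "nhd0 U"
  then obtain W where W: "nhd0 W" "\<And>x y. \<lbrakk>x \<in> W; y \<in> W\<rbrakk> \<Longrightarrow> x + y \<in> U" by (rule nhd0_add) blast
  have "absorbs sc W B" "absorbs sc W C" using assms W(1) by (simp_all add: tvs_bounded_def)
  then obtain r s where r: "r > 0" "\<And>c. r \<le> cmod c \<Longrightarrow> B \<subseteq> sc c ` W"
    and s: "s > 0" "\<And>c. s \<le> cmod c \<Longrightarrow> C \<subseteq> sc c ` W"
    unfolding absorbs_def by (elim exE conjE) simp
  show "absorbs sc U {b + c | b c. b \<in> B \<and> c \<in> C}"
    unfolding absorbs_def
  proof (intro exI conjI allI impI subsetI)
    show "0 < max r s" using r by simp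
    fix a z assume a: "max r s \<le> cmod a" and "z \<in> {b + c | b c. b \<in> B \<and> c \<in> C}"
    then obtain b c where z: "b \<in> B" "c \<in> C" "z = b + c" by blast
    have "b \<in> sc a ` W" "c \<in> sc a ` W" using subsetD[OF r(2) z(1)] subsetD[OF s(2) z(2)] a by simp_all
    then obtain x y where xy: "b = sc a x" "x \<in> W" "c = sc a y" "y \<in> W" by (elim imageE)
    have "z = sc a (x + y)" using xy z(3) by (simp add: scale_right_distrib)
    then show "z \<in> sc a ` U" using W(2)[OF xy(2,4)] by (rule image_eqI)
  qed
qed

lemma abs_convex_sum:
  assumes B: "abs_convex sc B" and C: "abs_convex sc C"
  shows "abs_convex sc {b + c | b c. b \<in> B \<and> c \<in> C}"
  unfolding abs_convex_def
proof (intro conjI ballI allI impI)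
  show "{b + c | b c. b \<in> B \<and> c \<in> C} \<noteq> {}" using zero_in_abs_convex[OF B] zero_in_abs_convex[OF C] by blast
  fix x y p q assume "x \<in> {b + c | b c. b \<in> B \<and> c \<in> C}" "y \<in> {b + c | b c. b \<in> B \<and> c \<in> C}"
    and pq: "cmod p + cmod q \<le> 1"
  then obtain b c b' c' where *: "b \<in> B" "c \<in> C" "x = b + c" "b' \<in> B" "c' \<in> C" "y = b' + c'" by blast
  have "sc p x + sc q y = (sc p b + sc q b') + (sc p c + sc q c')"
    using * by (simp add: scale_right_distrib algebra_simps)
  then show "sc p x + sc q y \<in> {b + c | b c. b \<in> B \<and> c \<in> C}"
    using abs_convexD[OF B *(1,4) pq] abs_convexD[OF C *(2,5) pq] by blast
qed

theorem ind_banach_IB: "ind_banach (IB sc)"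
proof (rule ind_banach.intro)
  have "abs_convex sc {0}" by (simp add: abs_convex_def)
  moreover have "tvs_bounded sc {0}"
    unfolding tvs_bounded_def absorbs_def nhd0_def
    by (intro allI impI exI[of _ 1]) (use eventually_nhds_x_imp_x in \<open>force\<close>)
  ultimately show "idx (IB sc) \<noteq> {}" by (auto simp: IB_def)
  show "leq (IB sc) B B" for B by (simp add: IB_def)
  show "leq (IB sc) B D" if "leq (IB sc) B C" "leq (IB sc) C D" for B C D using that by (auto simp: IB_def)
  show "\<exists>D\<in>idx (IB sc). leq (IB sc) B D \<and> leq (IB sc) C D"
    if "B \<in> idx (IB sc)" "C \<in> idx (IB sc)" for B C
  proof (rule bexI[of _ "{b + c | b c. b \<in> B \<and> c \<in> C}"])
    have BC: "abs_convex sc B" "abs_convex sc C" using that by (auto simp: IB_def)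
    show "leq (IB sc) B {b + c | b c. b \<in> B \<and> c \<in> C} \<and> leq (IB sc) C {b + c | b c. b \<in> B \<and> c \<in> C}"
      using BC[THEN zero_in_abs_convex] by (force simp: IB_def)
    show "{b + c | b c. b \<in> B \<and> c \<in> C} \<in> idx (IB sc)"
      using that by (simp add: IB_def bounded_sum abs_convex_sum)
  qed
  show "banach_space (obj (IB sc) B)" if "B \<in> idx (IB sc)" for B
    using that by (auto simp: IB_def intro!: seminormed_space.banach_completion seminormed_hull_space)
  have hom: "seminormed_hom (hull_space sc B) (hull_space sc C) id 1"
    if "B \<in> idx (IB sc)" "C \<in> idx (IB sc)" "leq (IB sc) B C" for B C
    using that by (intro inclusion_hom) (auto simp: IB_def)
  show "trans_map (IB sc) B C \<in> ban_hom (obj (IB sc) B) (obj (IB sc) C)"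
    if "B \<in> idx (IB sc)" "C \<in> idx (IB sc)" "leq (IB sc) B C" for B C
    using seminormed_hom.completion_map_hom[OF hom[OF that]] by (simp add: IB_def)
  have cls: "trans_map (IB sc) B C (seminormed_space.cls (hull_space sc B) s)
      = seminormed_space.cls (hull_space sc C) s"
    if "B \<in> idx (IB sc)" "C \<in> idx (IB sc)" "leq (IB sc) B C" "s \<in> cauchy_seqs (hull_space sc B)" for B C s
    using seminormed_hom.completion_map_cls[OF hom[OF that(1-3)] that(4)] by (simp add: IB_def)
  have ext: "trans_map (IB sc) B C \<in> extensional (vcarrier (obj (IB sc) B))" for B C
    by (simp add: IB_def completion_map_def)
  have carE: "\<exists>s\<in>cauchy_seqs (hull_space sc B). x = seminormed_space.cls (hull_space sc B) s"
    if "B \<in> idx (IB sc)" "x \<in> vcarrier (obj (IB sc) B)" for B x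
    using that seminormed_space.carrier_completionE[OF seminormed_hull_space, of B x]
    by (auto simp: IB_def)
  show "trans_map (IB sc) B B = restrict id (vcarrier (obj (IB sc) B))" if B: "B \<in> idx (IB sc)" for B
  proof (rule extensionalityI[OF ext])
    fix x assume x: "x \<in> vcarrier (obj (IB sc) B)"
    then obtain s where "s \<in> cauchy_seqs (hull_space sc B)" "x = seminormed_space.cls (hull_space sc B) s"
      using carE[OF B] by blast
    then show "trans_map (IB sc) B B x = restrict id (vcarrier (obj (IB sc) B)) x"
      using x cls[OF B B] by (simp add: IB_def)
  qed simp
  show "compose (vcarrier (obj (IB sc) B)) (trans_map (IB sc) C D) (trans_map (IB sc) B C) = trans_map (IB sc) B D"
    if "B \<in> idx (IB sc)" "C \<in> idx (IB sc)" "D \<in> idx (IB sc)" "leq (IB sc) B C" "leq (IB sc) C D" for B C D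
  proof (rule extensionalityI[OF _ ext])
    fix x assume x: "x \<in> vcarrier (obj (IB sc) B)"
    then obtain s where s: "s \<in> cauchy_seqs (hull_space sc B)" "x = seminormed_space.cls (hull_space sc B) s"
      using carE[OF \<open>B \<in> idx (IB sc)\<close>] by blast
    have sC: "s \<in> cauchy_seqs (hull_space sc C)"
      using seminormed_hom.cauchy_image[OF hom[OF that(1,2,4)] s(1)] by simp
    have "leq (IB sc) B D" using that by (auto simp: IB_def)
    then show "compose (vcarrier (obj (IB sc) B)) (trans_map (IB sc) C D) (trans_map (IB sc) B C) x
        = trans_map (IB sc) B D x"
      using x s sC that cls by (simp add: compose_eq)
  qed (simp add: compose_extensional)
qed

end

end

theory Submission
  imports Defs
begin

text \<open>
  Write \<open>E\<^sub>B\<close> and \<open>F\<^sub>C\<close> for the completed hulls of bounded absolutely convex sets \<open>B\<close> and \<open>C\<close>.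
  If \<open>F\<close> is complete, there is a canonical continuous linear map \<open>ev : F\<^sub>C \<rightarrow> F\<close>: a sequence
  that is Cauchy for the gauge of \<open>C\<close> is Cauchy for the coarser uniformity of \<open>F\<close>, so it has a limit there, and only one.  These maps
  commute with the transition maps.  When \<open>C\<close> is closed, \<open>ev\<close> is injective
  (\<open>ev_inj_on_closed\<close>): a gauge-Cauchy sequence that tends to zero in \<open>F\<close> tends to zero for
  the gauge, because the estimates \<open>s\<^sub>n - s\<^sub>m \<in> \<epsilon>C\<close> pass to the limit in \<open>m\<close>.  Since closures
  of bounded absolutely convex sets are again bounded and absolutely convex, the closed indices
  are cofinal.

  Consequently two morphisms \<open>u : V \<rightarrow> F\<^sub>C\<close> and \<open>v : V \<rightarrow> F\<^sub>D\<close> represent the same element of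
  the inductive limit \<open>lim Hom(V, F\<^sub>C)\<close> exactly when \<open>ev \<circ> u = ev \<circ> v\<close> (\<open>colim_rel_iff\<close>).
  So an element of this limit is the same as a linear map \<open>V \<rightarrow> F\<close> of a certain kind, and sums,
  multiples and precompositions of classes are computed on these maps.

  For a continuous linear \<open>f : E \<rightarrow> F\<close> the map attached to the component of \<open>IB(f)\<close> at \<open>B\<close> sends
  the class of a Cauchy sequence \<open>s\<close> to \<open>lim f(s\<^sub>n)\<close>.  Compatibility with the
  transition maps and linearity of \<open>f \<mapsto> IB(f)\<close> follow by uniqueness of limits, and
  constant sequences recover \<open>f\<close> from \<open>IB(f)\<close>, which gives injectivity.

  For surjectivity, represent the component at \<open>B\<close> of a morphism \<open>\<phi>\<close> by \<open>u : E\<^sub>B \<rightarrow> F\<^sub>C\<close> and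
  restrict \<open>ev \<circ> u\<close> to the hull of \<open>B\<close>.  Compatibility of the components makes these linear maps
  agree on smaller hulls, and the hulls exhaust \<open>E\<close> directedly, so they glue to a linear map
  \<open>f : E \<rightarrow> F\<close>.  By continuity of \<open>u\<close> it maps \<open>B\<close> into a multiple of the closure of \<open>C\<close>; thus \<open>f\<close>
  maps bounded sets to bounded sets, and it is continuous because \<open>E\<close> is bornological
  (\<open>bornological_continuous\<close>).  Density of the hull of \<open>B\<close> in its completion gives
  \<open>IB(f) = \<phi>\<close>.
\<close>

section \<open>Bounded sets in locally convex spaces\<close>

context complex_vector_space
begin

lemma abs_convex_Inter:
  assumes "\<And>D. D \<in> \<D> \<Longrightarrow> abs_convex sc D"
  shows "abs_convex sc (\<Inter>\<D>)"
proof -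
  have "0 \<in> \<Inter>\<D>" using assms zero_in_abs_convex by blast
  then show ?thesis using assms abs_convexD unfolding abs_convex_def by blast
qed

lemma abs_convex_image_scale:
  assumes V: "abs_convex sc V" shows "abs_convex sc (sc c ` V)"
  unfolding abs_convex_def
proof (intro conjI ballI allI impI)
  show "sc c ` V \<noteq> {}" using V by (simp add: abs_convex_def)
  fix x y a b assume "x \<in> sc c ` V" "y \<in> sc c ` V" and ab: "cmod a + cmod b \<le> 1"
  then obtain v w where vw: "v \<in> V" "x = sc c v" "w \<in> V" "y = sc c w" by blast
  have "sc a x + sc b y = sc c (sc a v + sc b w)"
    using vw by (simp add: scale_right_distrib mult.commute)
  then show "sc a x + sc b y \<in> sc c ` V" using abs_convexD[OF V vw(1,3) ab] by (rule image_eqI)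
qed

text \<open>
  A balanced set absorbs \<open>A\<close> as soon as one of its dilates contains \<open>A\<close>, since its dilates
  grow with the modulus of the factor.
\<close>

lemma absorbs_iff_abs_convex:
  assumes V: "abs_convex sc V"
  shows "absorbs sc V A \<longleftrightarrow> (\<exists>r>0. A \<subseteq> sc (of_real r) ` V)"
proof
  assume "absorbs sc V A"
  then obtain r where r: "r > 0" "\<And>c. r \<le> cmod c \<Longrightarrow> A \<subseteq> sc c ` V"
    unfolding absorbs_def by blast
  have "A \<subseteq> sc (of_real r) ` V" by (rule r(2)) (use r(1) in simp)
  with r(1) show "\<exists>r>0. A \<subseteq> sc (of_real r) ` V" by blast
next
  assume "\<exists>r>0. A \<subseteq> sc (of_real r) ` V"
  then obtain r where r: "r > 0" "A \<subseteq> sc (of_real r) ` V" by blast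
  have "A \<subseteq> sc c ` V" if c: "r \<le> cmod c" for c
  proof
    fix x assume "x \<in> A"
    then obtain v where v: "v \<in> V" "x = sc (of_real r) v" using r(2) by blast
    have c0: "c \<noteq> 0" using c r(1) by auto
    have "cmod (of_real r / c) \<le> 1" using c r(1) c0 by (simp add: norm_divide)
    with v(1) have "sc (of_real r / c) v \<in> V" by (rule abs_convex_scale[OF V])
    moreover have "x = sc c (sc (of_real r / c) v)" using v(2) c0 by simp
    ultimately show "x \<in> sc c ` V" by (rule rev_image_eqI)
  qed
  then show "absorbs sc V A" unfolding absorbs_def using r(1) by blast
qed

lemma absorbs_mono: "\<lbrakk>absorbs sc U A; U \<subseteq> U'; A' \<subseteq> A\<rbrakk> \<Longrightarrow> absorbs sc U' A'"
  unfolding absorbs_def by (meson image_mono order_trans)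

end

lemma zero_in_nhd0: "nhd0 U \<Longrightarrow> 0 \<in> U"
  unfolding nhd0_def by (rule eventually_nhds_x_imp_x)

lemma nhd0_mono: "\<lbrakk>nhd0 U; U \<subseteq> W\<rbrakk> \<Longrightarrow> nhd0 W"
  unfolding nhd0_def by (erule eventually_mono) blast

lemma tendsto_iff_nhd0:
  fixes f :: "'i \<Rightarrow> 'a::topological_ab_group_add"
  shows "(f \<longlongrightarrow> l) F \<longleftrightarrow> (\<forall>U. nhd0 U \<longrightarrow> (\<forall>\<^sub>F n in F. f n - l \<in> U))"
proof -
  have "(f \<longlongrightarrow> l) F \<longleftrightarrow> ((\<lambda>n. f n - l) \<longlongrightarrow> 0) F"
    using tendsto_diff[of f l F "\<lambda>_. l" l] tendsto_add[of "\<lambda>n. f n - l" 0 F "\<lambda>_. l" l] by auto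
  also have "\<dots> \<longleftrightarrow> (\<forall>U. nhd0 U \<longrightarrow> (\<forall>\<^sub>F n in F. f n - l \<in> U))"
  proof
    assume "((\<lambda>n. f n - l) \<longlongrightarrow> 0) F"
    then show "\<forall>U. nhd0 U \<longrightarrow> (\<forall>\<^sub>F n in F. f n - l \<in> U)"
      unfolding nhd0_def filterlim_iff by blast
  next
    assume *: "\<forall>U. nhd0 U \<longrightarrow> (\<forall>\<^sub>F n in F. f n - l \<in> U)"
    show "((\<lambda>n. f n - l) \<longlongrightarrow> 0) F"
      unfolding filterlim_iff
    proof (intro allI impI)
      fix P :: "'a \<Rightarrow> bool" assume "eventually P (nhds 0)"
      then show "\<forall>\<^sub>F n in F. P (f n - l)" using *[rule_format, of "Collect P"] by (simp add: nhd0_def)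
    qed
  qed
  finally show ?thesis .
qed

context lctvs
begin

lemma continuous_on_sc: "continuous_on UNIV (sc c)"
  using continuous_on_compose2[OF continuous_scale, of UNIV "\<lambda>x. (c, x)"]
  by (simp add: continuous_on_Pair continuous_on_const continuous_on_id)

lemma tendsto_sc: "(f \<longlongrightarrow> l) F \<Longrightarrow> ((\<lambda>n. sc c (f n)) \<longlongrightarrow> sc c l) F"
  by (rule continuous_on_tendsto_compose[OF continuous_on_sc]) auto

lemma nhd0_scale:
  assumes U: "nhd0 U" and c: "c \<noteq> 0"
  shows "nhd0 (sc c ` U)"
proof -
  have "((\<lambda>x. sc (1/c) x) \<longlongrightarrow> 0) (nhds 0)"
    using tendsto_sc[OF filterlim_ident, where c = "1/c" and l = 0] by simp
  then have "\<forall>\<^sub>F x in nhds 0. sc (1/c) x - 0 \<in> U" using U unfolding tendsto_iff_nhd0 by blast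
  then show ?thesis unfolding nhd0_def
  proof (rule eventually_mono)
    fix x assume "sc (1/c) x - 0 \<in> U"
    then show "x \<in> sc c ` U" using c by (intro image_eqI[of _ _ "sc (1/c) x"]) simp_all
  qed
qed

text \<open>
  The points of a convex neighbourhood \<open>K\<close> whose whole disc of multiples lies in \<open>K\<close> form an
  absolutely convex set; joint continuity of the scalar multiplication at \<open>(0, 0)\<close> makes it a
  neighbourhood of zero.
\<close>

lemma nhd0_abs_convex:
  assumes U: "nhd0 U"
  obtains V where "V \<subseteq> U" "nhd0 V" "abs_convex sc V"
proof -
  obtain K where K: "K \<subseteq> U" "nhd0 K" "convex_over sc K" using locally_convex[OF U] by blast
  define W where "W = {x. \<forall>c. cmod c \<le> 1 \<longrightarrow> sc c x \<in> K}"
  have "W \<subseteq> K"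
  proof
    fix x assume "x \<in> W"
    then have "sc 1 x \<in> K" unfolding W_def by (metis (mono_tags) mem_Collect_eq norm_one order_refl)
    then show "x \<in> K" by simp
  qed
  moreover have "nhd0 W"
  proof -
    have "((\<lambda>p. sc (fst p) (snd p)) \<longlongrightarrow> sc 0 0) (nhds (0, 0))"
      using continuous_on_tendsto_compose[OF continuous_scale filterlim_ident, of "(0, 0)"]
      by (simp add: case_prod_beta')
    then have "\<forall>\<^sub>F p in nhds 0 \<times>\<^sub>F nhds 0. sc (fst p) (snd p) - 0 \<in> K"
      using K(2) unfolding tendsto_iff_nhd0 by (simp add: nhds_prod)
    then obtain P Q where PQ: "eventually P (nhds (0::complex))" "eventually Q (nhds (0::'a))"
      "\<And>c x. P c \<Longrightarrow> Q x \<Longrightarrow> sc c x \<in> K"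
      unfolding eventually_prod_filter by auto
    obtain d where d: "d > 0" "\<And>c. cmod c < d \<Longrightarrow> P c"
      using PQ(1) unfolding eventually_nhds_metric by (auto simp: dist_norm)
    have "nhd0 (sc (of_real (d/2)) ` Collect Q)"
      using PQ(2) d(1) by (intro nhd0_scale) (simp_all add: nhd0_def)
    moreover have "sc (of_real (d/2)) ` Collect Q \<subseteq> W"
      unfolding W_def
    proof (clarsimp)
      fix x c assume x: "Q x" and c: "cmod c \<le> 1"
      have "cmod (c * of_real d / 2) = cmod c * d / 2" using d(1) by (simp add: norm_mult norm_divide)
      also have "\<dots> \<le> 1 * d / 2" using c d(1) by (intro divide_right_mono mult_right_mono) simp_all
      also have "\<dots> < d" using d(1) by simp
      finally show "sc (c * of_real d / 2) x \<in> K" using PQ(3)[OF d(2) x] by blast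
    qed
    ultimately show ?thesis by (rule nhd0_mono)
  qed
  moreover have "abs_convex sc W"
    unfolding abs_convex_def
  proof (intro conjI ballI allI impI)
    show "W \<noteq> {}" using zero_in_nhd0[OF \<open>nhd0 W\<close>] by blast
    fix x y a b assume x: "x \<in> W" and y: "y \<in> W" and ab: "cmod a + cmod b \<le> 1"
    have "sc c (sc a x + sc b y) \<in> K" if c: "cmod c \<le> 1" for c
    proof -
      \<comment> \<open>Write the combination as a convex one: the moduli go into the weights \<open>\<alpha>\<close>, \<open>\<beta>\<close> and the
        remaining factors \<open>e\<close>, \<open>e'\<close> have modulus at most one.\<close>
      define \<alpha> where "\<alpha> = cmod a"
      define \<beta> where "\<beta> = 1 - cmod a"
      define e where "e = a / of_real \<alpha>"
      define e' where "e' = b / of_real \<beta>"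
      have ab': "0 \<le> \<alpha>" "0 \<le> \<beta>" "\<alpha> + \<beta> = 1" "cmod b \<le> \<beta>"
        using ab norm_ge_zero[of b] norm_ge_zero[of a] unfolding \<alpha>_def \<beta>_def by linarith+
      have a: "a = of_real \<alpha> * e" by (simp add: e_def \<alpha>_def)
      have b: "b = of_real \<beta> * e'" using ab'(4) by (cases "\<beta> = 0") (simp_all add: e'_def)
      have e: "cmod e \<le> 1" by (simp add: e_def \<alpha>_def norm_divide)
      have e': "cmod e' \<le> 1" using ab'(2,4) by (auto simp: e'_def norm_divide divide_le_eq_1)
      have "sc (c * e) x \<in> K" "sc (c * e') y \<in> K"
        using x y c e e' by (auto simp: W_def norm_mult mult_le_one)
      then have "sc (of_real \<alpha>) (sc (c * e) x) + sc (of_real \<beta>) (sc (c * e') y) \<in> K"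
        using K(3) ab'(1-3) unfolding convex_over_def by blast
      moreover have "sc c (sc a x + sc b y)
          = sc (of_real \<alpha>) (sc (c * e) x) + sc (of_real \<beta>) (sc (c * e') y)"
        by (subst a, subst b) (simp add: scale_right_distrib mult_ac)
      ultimately show ?thesis by simp
    qed
    then show "sc a x + sc b y \<in> W" by (simp add: W_def)
  qed
  ultimately show ?thesis using K(1) that by blast
qed

lemma bounded_iff_abs_convex:
  "tvs_bounded sc A \<longleftrightarrow>
    (\<forall>V. nhd0 V \<and> abs_convex sc V \<longrightarrow> (\<exists>r>0. A \<subseteq> sc (of_real r) ` V))"
  unfolding tvs_bounded_def
  by (meson absorbs_iff_abs_convex absorbs_mono nhd0_abs_convex order_refl)

lemma tendsto_iff_abs_convex:
  "(f \<longlongrightarrow> l) F \<longleftrightarrow> (\<forall>V. nhd0 V \<and> abs_convex sc V \<longrightarrow> (\<forall>\<^sub>F n in F. f n - l \<in> V))"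
  unfolding tendsto_iff_nhd0
proof (intro iffI allI impI)
  fix U :: "'a set" assume *: "\<forall>V. nhd0 V \<and> abs_convex sc V \<longrightarrow> (\<forall>\<^sub>F n in F. f n - l \<in> V)" and "nhd0 U"
  obtain V where V: "V \<subseteq> U" "nhd0 V" "abs_convex sc V" using nhd0_abs_convex[OF \<open>nhd0 U\<close>] .
  then have "\<forall>\<^sub>F n in F. f n - l \<in> V" using * by blast
  then show "\<forall>\<^sub>F n in F. f n - l \<in> U" by (rule eventually_mono) (use V in blast)
qed blast

lemma closure_abs_convex:
  assumes C: "abs_convex sc C" shows "abs_convex sc (closure C)"
  unfolding abs_convex_def
proof (intro conjI ballI allI impI)
  show "closure C \<noteq> {}" using C by (simp add: abs_convex_def)
  fix x y a b assume xy: "x \<in> closure C" "y \<in> closure C" and ab: "cmod a + cmod b \<le> 1"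
  let ?h = "\<lambda>p. sc a (fst p) + sc b (snd p)"
  have "continuous_on (closure (C \<times> C)) ?h"
    by (intro continuous_on_add continuous_on_compose2[OF continuous_on_sc]
        continuous_on_fst continuous_on_snd continuous_on_id) auto
  then have "?h ` closure (C \<times> C) \<subseteq> closure C"
  proof (rule image_closure_subset)
    show "?h ` (C \<times> C) \<subseteq> closure C"
      using abs_convexD[OF C _ _ ab] closure_subset[of C] by auto
  qed simp
  then have "?h (x, y) \<in> closure C" using xy unfolding closure_Times by blast
  then show "sc a x + sc b y \<in> closure C" by simp
qed

text \<open>
  If \<open>C \<subseteq> rV\<close>, a point \<open>x\<close> of the closure differs from some point of \<open>C\<close> by an element of the
  neighbourhood \<open>rV\<close>, hence \<open>x \<in> rV + rV = 2rV\<close>.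
\<close>

lemma closure_bounded:
  assumes C: "tvs_bounded sc C" shows "tvs_bounded sc (closure C)"
  unfolding bounded_iff_abs_convex
proof (intro allI impI, elim conjE)
  fix V assume V: "nhd0 V" "abs_convex sc V"
  obtain r where r: "r > 0" "C \<subseteq> sc (of_real r) ` V" using C V unfolding bounded_iff_abs_convex by blast
  have "closure C \<subseteq> sc (of_real (2*r)) ` V"
  proof
    fix x assume x: "x \<in> closure C"
    have "((\<lambda>y. y) \<longlongrightarrow> x) (nhds x)" by (rule filterlim_ident)
    moreover have "nhd0 (sc (of_real r) ` V)" using V(1) r(1) by (intro nhd0_scale) simp_all
    ultimately have "\<forall>\<^sub>F y in nhds x. y - x \<in> sc (of_real r) ` V" unfolding tendsto_iff_nhd0 by blast
    then obtain S where S: "open S" "x \<in> S" "\<forall>y\<in>S. y - x \<in> sc (of_real r) ` V"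
      unfolding eventually_nhds by blast
    obtain y where y: "y \<in> S" "y \<in> C" using x S(1,2) by (auto simp: closure_iff_nhds_not_empty)
    obtain v where v: "v \<in> V" "y - x = sc (of_real r) v" using S(3) y(1) by blast
    obtain w where w: "w \<in> V" "y = sc (of_real r) w" using r(2) y(2) by blast
    have "cmod (1/2) + cmod (-1/2) \<le> 1" by (simp add: norm_divide)
    then have "sc (1/2) w + sc (-1/2) v \<in> V" by (rule abs_convexD[OF V(2) w(1) v(1)])
    moreover have "x = sc (of_real (2*r)) (sc (1/2) w + sc (-1/2) v)"
      using v(2) w(2) by (simp add: scale_right_distrib algebra_simps)
    ultimately show "x \<in> sc (of_real (2*r)) ` V" by (rule rev_image_eqI)
  qed
  then show "\<exists>r>0. closure C \<subseteq> sc (of_real r) ` V" using r(1) by (intro exI[of _ "2*r"]) simp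
qed

lemma idx_IB: "B \<in> idx (IB sc) \<longleftrightarrow> abs_convex sc B \<and> tvs_bounded sc B"
  by (simp add: IB_def)

text \<open>
  The absolutely convex hull of a bounded set is bounded because zero has a base of absolutely
  convex neighbourhoods.
\<close>

lemma bounded_subset_idx:
  assumes A: "tvs_bounded sc A"
  obtains B where "B \<in> idx (IB sc)" "A \<subseteq> B"
proof
  let ?H = "\<Inter>{D. abs_convex sc D \<and> A \<subseteq> D}"
  show "A \<subseteq> ?H" by blast
  have "tvs_bounded sc ?H"
    unfolding bounded_iff_abs_convex
  proof (intro allI impI, elim conjE)
    fix V assume V: "nhd0 V" "abs_convex sc V"
    obtain r where r: "r > 0" "A \<subseteq> sc (of_real r) ` V" using A V unfolding bounded_iff_abs_convex by blast
    then show "\<exists>r>0. ?H \<subseteq> sc (of_real r) ` V"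
      using abs_convex_image_scale[OF V(2)] by blast
  qed
  then show "?H \<in> idx (IB sc)" by (auto simp: idx_IB intro: abs_convex_Inter)
qed

lemma bounded_singleton: "tvs_bounded sc {x}"
  unfolding bounded_iff_abs_convex
proof (intro allI impI, elim conjE)
  fix V assume V: "nhd0 V" "abs_convex sc V"
  have "((\<lambda>c. sc c x) \<longlongrightarrow> sc 0 x) (nhds 0)"
    using continuous_on_tendsto_compose[OF continuous_scale, of "\<lambda>c. (c, x)" "(0, x)" "nhds 0"]
    by (simp add: tendsto_Pair filterlim_ident)
  then have "\<forall>\<^sub>F c in nhds 0. sc c x - 0 \<in> V" using V(1) unfolding tendsto_iff_nhd0 by simp
  then obtain d where d: "d > 0" "\<And>c. cmod c < d \<Longrightarrow> sc c x \<in> V"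
    unfolding eventually_nhds_metric by (auto simp: dist_norm)
  have "x = sc (of_real (2/d)) (sc (of_real (d/2)) x)" using d(1) by simp
  moreover have "sc (of_real (d/2)) x \<in> V" using d(1) by (intro d(2)) (simp add: norm_divide)
  ultimately have "{x} \<subseteq> sc (of_real (2/d)) ` V" by blast
  then show "\<exists>r>0. {x} \<subseteq> sc (of_real r) ` V" using d(1) by (intro exI[of _ "2/d"]) simp
qed

lemma point_in_idx: obtains B where "B \<in> idx (IB sc)" "x \<in> B"
  using bounded_subset_idx[OF bounded_singleton] by blast

text \<open>
  The closed indices are cofinal: an upper bound may be replaced by its closure.
\<close>

lemma upper_bound_closed:
  assumes "B \<in> idx (IB sc)" "C \<in> idx (IB sc)"
  obtains D where "D \<in> idx (IB sc)" "B \<subseteq> D" "C \<subseteq> D" "closed D"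
proof -
  obtain D where D: "D \<in> idx (IB sc)" "leq (IB sc) B D" "leq (IB sc) C D"
    using ind_banach.directed[OF ind_banach_IB assms] by blast
  have "closure D \<in> idx (IB sc)" using D(1) by (simp add: idx_IB closure_abs_convex closure_bounded)
  then show ?thesis by (rule that) (use D closure_subset[of D] in \<open>auto simp: IB_def\<close>)
qed

end

context lctvs
begin

text \<open>
  Boundedness of \<open>C\<close> makes the gauge topology on its hull finer than the topology induced by the
  space.
\<close>

lemma gauge_small_in_nhd0:
  assumes C: "C \<in> idx (IB sc)" and U: "nhd0 U"
  obtains d where "d > 0" "\<And>x. \<lbrakk>x \<in> span C; gauge_seminorm sc C x < d\<rbrakk> \<Longrightarrow> x \<in> U"
proof -
  have Cc: "abs_convex sc C" and Cb: "tvs_bounded sc C" using C by (simp_all add: idx_IB)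
  obtain r where r: "r > 0" "\<And>c. r \<le> cmod c \<Longrightarrow> C \<subseteq> sc c ` U"
    using Cb U unfolding tvs_bounded_def absorbs_def by blast
  have "C \<subseteq> sc (of_real r) ` U" by (rule r(2)) (use r(1) in simp)
  have "x \<in> U" if x: "x \<in> span C" "gauge_seminorm sc C x < 1/r" for x
  proof -
    have "x \<in> dil C (1/r)" by (rule gauge_less[OF Cc x])
    then obtain c where c: "c \<in> C" "x = sc (of_real (1/r)) c" by blast
    obtain u where "u \<in> U" "c = sc (of_real r) u" using c(1) \<open>C \<subseteq> sc (of_real r) ` U\<close> by blast
    then show "x \<in> U" using c(2) r(1) by simp
  qed
  then show ?thesis using r(1) by (intro that[of "1/r"]) simp_all
qed

lemma hull_space_simps [simp]:
  "vcarrier (hull_space sc B) = span B" "vadd (hull_space sc B) = (+)"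
  "vzero (hull_space sc B) = 0" "vscale (hull_space sc B) = sc"
  "vnorm (hull_space sc B) = gauge_seminorm sc B"
  by (simp_all add: hull_space_def)

lemma vdist_hull_space: "vdist (hull_space sc B) x y = gauge_seminorm sc B (x - y)"
  by (simp add: vdist_def)

lemma gauge_dist_tendsto:
  assumes C: "C \<in> idx (IB sc)" and sp: "\<And>n. f n - g n \<in> span C"
    and lim: "((\<lambda>n. gauge_seminorm sc C (f n - g n)) \<longlongrightarrow> 0) F"
  shows "((\<lambda>n. f n - g n) \<longlongrightarrow> 0) F"
  unfolding tendsto_iff_nhd0
proof (intro allI impI)
  fix U :: "'a set" assume "nhd0 U"
  from gauge_small_in_nhd0[OF C this] obtain d where
    d: "d > 0" "\<And>x. \<lbrakk>x \<in> span C; gauge_seminorm sc C x < d\<rbrakk> \<Longrightarrow> x \<in> U" by blast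
  from order_tendstoD(2)[OF lim d(1)]
  show "\<forall>\<^sub>F n in F. f n - g n - 0 \<in> U" by (rule eventually_mono) (simp add: d(2) sp)
qed

abbreviation cl :: "'a set \<Rightarrow> (nat \<Rightarrow> 'a) \<Rightarrow> (nat \<Rightarrow> 'a) set"
  where "cl C \<equiv> seminormed_space.cls (hull_space sc C)"

abbreviation banach_of :: "'a set \<Rightarrow> (nat \<Rightarrow> 'a) set seminormed"
  where "banach_of C \<equiv> hcompletion (hull_space sc C)"

lemma obj_IB [simp]: "obj (IB sc) C = banach_of C" by (simp add: IB_def)
lemma leq_IB [simp]: "leq (IB sc) C D \<longleftrightarrow> C \<subseteq> D" by (simp add: IB_def)

end

section \<open>Evaluating completed hulls in a complete space\<close>

locale complete_lctvs = lctvs sc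
  for sc :: "complex \<Rightarrow> 'a::topological_ab_group_add \<Rightarrow> 'a" +
  assumes complete: "tvs_complete TYPE('a)"
begin

lemma lim_unique:
  fixes x y :: 'a
  assumes "(f \<longlongrightarrow> x) F" "(f \<longlongrightarrow> y) F" "F \<noteq> bot" shows "x = y"
proof -
  have "Hausdorff_space (euclidean :: 'a topology)" using complete by (simp add: tvs_complete_def)
  then show ?thesis using assms limitin_Hausdorff_unique[of euclidean f x F y] by simp
qed

text \<open>
  Completeness is formulated with Cauchy filters; it is applied to the filter generated by the
  tails of the sequence.
\<close>

lemma cauchy_seq_converges:
  fixes s :: "nat \<Rightarrow> 'a"
  assumes s: "\<And>U::'a set. nhd0 U \<Longrightarrow> \<exists>N. \<forall>m\<ge>N. \<forall>n\<ge>N. s m - s n \<in> U"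
  obtains x where "s \<longlonglongrightarrow> x"
proof -
  let ?F = "filtermap s sequentially"
  have "?F \<times>\<^sub>F ?F \<le> tvs_uniformity"
    unfolding tvs_uniformity_def filtermap_le_iff_le_filtercomap[symmetric]
  proof (rule filter_leI)
    fix P :: "'a \<Rightarrow> bool" assume "eventually P (nhds 0)"
    then obtain N where N: "\<And>m n. \<lbrakk>m \<ge> N; n \<ge> N\<rbrakk> \<Longrightarrow> P (s m - s n)"
      using s[of "Collect P"] by (auto simp: nhd0_def)
    let ?T = "\<lambda>x. \<exists>n\<ge>N. x = s n"
    have "eventually ?T ?F"
      unfolding eventually_filtermap eventually_sequentially by blast
    moreover have "P (x - y)" if "?T x" "?T y" for x y using that N by blast
    ultimately show "eventually P (filtermap (\<lambda>(x, y). x - y) (?F \<times>\<^sub>F ?F))"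
      unfolding eventually_filtermap eventually_prod_filter
      by (intro exI[of _ ?T]) simp
  qed
  moreover have "?F \<noteq> bot" by (simp add: filtermap_bot_iff)
  ultimately obtain x where "?F \<le> nhds x" using complete unfolding tvs_complete_def by blast
  then show ?thesis using that by (simp add: filterlim_def)
qed

lemma cauchy_hull_converges:
  assumes C: "C \<in> idx (IB sc)" and s: "s \<in> cauchy_seqs (hull_space sc C)"
  obtains x where "s \<longlonglongrightarrow> x"
proof (rule cauchy_seq_converges)
  fix U :: "'a set" assume "nhd0 U"
  from gauge_small_in_nhd0[OF C this] obtain d where
    d: "d > 0" "\<And>x. \<lbrakk>x \<in> span C; gauge_seminorm sc C x < d\<rbrakk> \<Longrightarrow> x \<in> U" by blast
  have sp: "s n \<in> span C" for n using s by (simp add: cauchy_seqs_def)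
  obtain N where "\<forall>m\<ge>N. \<forall>n\<ge>N. gauge_seminorm sc C (s m - s n) < d"
    using s d(1) unfolding cauchy_seqs_def vdist_hull_space by blast
  then show "\<exists>N. \<forall>m\<ge>N. \<forall>n\<ge>N. s m - s n \<in> U"
    using d(2) span_diff[OF sp sp] by blast
qed

text \<open>
  The canonical map from the completion of a hull to the space.  It is independent of the
  bounded set \<open>C\<close>, because a class is just a set of sequences with a common limit.
\<close>

definition ev :: "(nat \<Rightarrow> 'a) set \<Rightarrow> 'a"
  where "ev X = (THE l. \<forall>s\<in>X. s \<longlonglongrightarrow> l)"

context
  fixes C assumes C: "C \<in> idx (IB sc)"
begin

lemma idx_abs_convex: "abs_convex sc C" and idx_bounded: "tvs_bounded sc C" using C by (simp_all add: idx_IB)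

interpretation H: seminormed_space "hull_space sc C" by (rule seminormed_hull_space[OF idx_abs_convex])

lemma ev_cls_lim:
  assumes s: "s \<in> cauchy_seqs (hull_space sc C)"
  shows "s \<longlonglongrightarrow> ev (cl C s)"
proof -
  obtain l where l: "s \<longlonglongrightarrow> l" using cauchy_hull_converges[OF C s] .
  have "t \<longlonglongrightarrow> l" if "t \<in> cl C s" for t
  proof -
    have t: "t \<in> cauchy_seqs (hull_space sc C)"
      and st: "(\<lambda>n. gauge_seminorm sc C (s n - t n)) \<longlonglongrightarrow> 0"
      using H.in_clsD[OF that] by (simp_all add: null_rel_def vdist_hull_space)
    have "(\<lambda>n. s n - t n) \<longlonglongrightarrow> 0"
      by (rule gauge_dist_tendsto[OF C _ st])
        (use H.cauchy_closed[OF s] H.cauchy_closed[OF t] in \<open>auto intro: span_diff\<close>)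
    from tendsto_diff[OF l this] show ?thesis by simp
  qed
  then have "ev (cl C s) = l"
    unfolding ev_def using H.in_cls[OF s] lim_unique[of s _ sequentially l] l
    by (intro the_equality) auto
  with l show ?thesis by simp
qed

lemma ev_cls_eq: "\<lbrakk>s \<in> cauchy_seqs (hull_space sc C); s \<longlonglongrightarrow> l\<rbrakk> \<Longrightarrow> ev (cl C s) = l"
  using lim_unique[OF ev_cls_lim] by simp

lemma ev_add:
  assumes "X \<in> vcarrier (banach_of C)" "Y \<in> vcarrier (banach_of C)"
  shows "ev (vadd (banach_of C) X Y) = ev X + ev Y"
proof -
  obtain s where s: "s \<in> cauchy_seqs (hull_space sc C)" "X = cl C s"
    using H.carrier_completionE[OF assms(1)] .
  obtain t where t: "t \<in> cauchy_seqs (hull_space sc C)" "Y = cl C t"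
    using H.carrier_completionE[OF assms(2)] .
  show ?thesis
    using ev_cls_eq[OF H.cauchy_add[OF s(1) t(1)]]
      tendsto_add[OF ev_cls_lim[OF s(1)] ev_cls_lim[OF t(1)]]
    by (simp add: s t H.completion_add)
qed

lemma ev_scale:
  assumes "X \<in> vcarrier (banach_of C)"
  shows "ev (vscale (banach_of C) a X) = sc a (ev X)"
proof -
  obtain s where s: "s \<in> cauchy_seqs (hull_space sc C)" "X = cl C s"
    using H.carrier_completionE[OF assms] .
  show ?thesis
    using ev_cls_eq[OF H.cauchy_scale[OF s(1)]] tendsto_sc[OF ev_cls_lim[OF s(1)]]
    by (simp add: s H.completion_scale)
qed

text \<open>
  A class of norm less than one is represented by a sequence that eventually lies in \<open>C\<close>.
\<close>

lemma ev_unit_ball: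
  assumes X: "X \<in> vcarrier (banach_of C)" "vnorm (banach_of C) X < 1"
  shows "ev X \<in> closure C"
proof -
  obtain s where s: "s \<in> cauchy_seqs (hull_space sc C)" "X = cl C s"
    using H.carrier_completionE[OF X(1)] .
  have "(\<lambda>n. gauge_seminorm sc C (s n)) \<longlonglongrightarrow> vnorm (banach_of C) X"
    using H.completion_norm_lim[OF s(1)] s(2) by simp
  then have "\<forall>\<^sub>F n in sequentially. gauge_seminorm sc C (s n) < 1"
    using X(2) by (rule order_tendstoD)
  then have "\<forall>\<^sub>F n in sequentially. s n \<in> closure C"
  proof (rule eventually_mono)
    fix n assume "gauge_seminorm sc C (s n) < 1"
    then have "s n \<in> dil C 1" using H.cauchy_closed[OF s(1)] by (intro gauge_less[OF idx_abs_convex]) auto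
    then show "s n \<in> closure C" using closure_subset[of C] by auto
  qed
  moreover have "s \<longlonglongrightarrow> ev X" using ev_cls_lim[OF s(1)] s(2) by simp
  ultimately show ?thesis using Lim_in_closed_set[of "closure C" s sequentially "ev X"] by simp
qed

lemma ev_small:
  assumes X: "X \<in> vcarrier (banach_of C)" "vnorm (banach_of C) X < t" and t: "t > 0"
  shows "ev X \<in> sc (of_real t) ` closure C"
proof -
  interpret K: seminormed_space "banach_of C" by (rule H.seminormed_completion)
  let ?Y = "vscale (banach_of C) (of_real (1/t)) X"
  have "ev ?Y \<in> closure C"
  proof (rule ev_unit_ball)
    show "?Y \<in> vcarrier (banach_of C)" using X(1) by (rule K.scale_closed)
    show "vnorm (banach_of C) ?Y < 1" using X t
      by (simp add: K.norm_scale norm_divide)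
  qed
  then have "sc (of_real (1/t)) (ev X) \<in> closure C" by (simp only: ev_scale[OF X(1)])
  then show ?thesis using t by (intro image_eqI[of _ _ "sc (of_real (1/t)) (ev X)"]) simp_all
qed

text \<open>
  Continuity of \<open>ev\<close> at zero: it maps the ball of radius \<open>t\<close> into \<open>t\<close> times the closure of \<open>C\<close>, which
  is bounded.
\<close>

lemma ev_small_in_nhd0:
  assumes U: "nhd0 U"
  obtains d where "d > 0"
    "\<And>X. \<lbrakk>X \<in> vcarrier (banach_of C); vnorm (banach_of C) X < d\<rbrakk> \<Longrightarrow> ev X \<in> U"
proof -
  obtain V where V: "V \<subseteq> U" "nhd0 V" "abs_convex sc V" using nhd0_abs_convex[OF U] .
  obtain r where r: "r > 0" "closure C \<subseteq> sc (of_real r) ` V"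
    using closure_bounded[OF idx_bounded] V unfolding bounded_iff_abs_convex by blast
  show ?thesis
  proof (rule that[of "1/r"])
    show "1/r > 0" using r by simp
    fix X assume X: "X \<in> vcarrier (banach_of C)" "vnorm (banach_of C) X < 1/r"
    obtain c where c: "c \<in> closure C" "ev X = sc (of_real (1/r)) c"
      using ev_small[OF X] r(1) by auto
    obtain v where "v \<in> V" "c = sc (of_real r) v" using r(2) c(1) by blast
    then show "ev X \<in> U" using c(2) r(1) V(1) by auto
  qed
qed

lemma ev_tendsto:
  assumes X: "\<And>n. X n \<in> vcarrier (banach_of C)" and Y: "Y \<in> vcarrier (banach_of C)"
    and lim: "((\<lambda>n. vdist (banach_of C) (X n) Y) \<longlongrightarrow> 0) F"
  shows "((\<lambda>n. ev (X n)) \<longlongrightarrow> ev Y) F"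
  unfolding tendsto_iff_nhd0
proof (intro allI impI)
  interpret K: seminormed_space "banach_of C" by (rule H.seminormed_completion)
  fix U :: "'a set" assume "nhd0 U"
  from ev_small_in_nhd0[OF this] obtain d where d: "d > 0"
    "\<And>X. \<lbrakk>X \<in> vcarrier (banach_of C); vnorm (banach_of C) X < d\<rbrakk> \<Longrightarrow> ev X \<in> U" by blast
  from order_tendstoD(2)[OF lim d(1)]
  show "\<forall>\<^sub>F n in F. ev (X n) - ev Y \<in> U"
  proof (rule eventually_mono)
    fix n assume "vdist (banach_of C) (X n) Y < d"
    then have "ev (vadd (banach_of C) (X n) (K.neg Y)) \<in> U"
      unfolding vdist_def by (intro d(2) K.add_closed K.scale_closed X Y)
    then show "ev (X n) - ev Y \<in> U"
      by (simp add: ev_add[OF X K.scale_closed[OF Y]] ev_scale[OF Y])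
  qed
qed

text \<open>
  The difference \<open>z\<close> of two representatives is gauge-Cauchy and tends to zero in the space.  For
  large indices \<open>z\<^sub>n - z\<^sub>m\<close> lies in a small multiple of the closed set \<open>C\<close>; letting \<open>m\<close> tend to
  infinity, so does \<open>z\<^sub>n\<close>.  Hence \<open>z\<close> is null for the gauge.
\<close>

lemma ev_inj_on_closed:
  assumes cl: "closed C" shows "inj_on ev (vcarrier (banach_of C))"
proof (rule inj_onI)
  fix X Y assume XY: "X \<in> vcarrier (banach_of C)" "Y \<in> vcarrier (banach_of C)" "ev X = ev Y"
  obtain s where s: "s \<in> cauchy_seqs (hull_space sc C)" "X = cl C s"
    using H.carrier_completionE[OF XY(1)] .
  obtain t where t: "t \<in> cauchy_seqs (hull_space sc C)" "Y = cl C t"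
    using H.carrier_completionE[OF XY(2)] .
  have z: "(\<lambda>n. s n - t n) \<in> cauchy_seqs (hull_space sc C)"
    using H.cauchy_diff[OF s(1) t(1)] by simp
  have zsp: "s n - t n \<in> span C" for n using H.cauchy_closed[OF z] by simp
  have z0: "(\<lambda>n. s n - t n) \<longlonglongrightarrow> 0"
    using tendsto_diff[OF ev_cls_lim[OF s(1)] ev_cls_lim[OF t(1)]] s(2) t(2) XY(3) by simp
  have "(\<lambda>n. gauge_seminorm sc C (s n - t n)) \<longlonglongrightarrow> 0"
  proof (rule LIMSEQ_I)
    fix e :: real assume e: "e > 0"
    obtain N where N: "\<And>m n. \<lbrakk>N \<le> m; N \<le> n\<rbrakk> \<Longrightarrow>
        gauge_seminorm sc C ((s m - t m) - (s n - t n)) < e/2"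
      using H.cauchyE[OF z, of "e/2"] e unfolding vdist_hull_space by auto
    have "norm (gauge_seminorm sc C (s n - t n) - 0) < e" if n: "n \<ge> N" for n
    proof -
      let ?q = "\<lambda>m. sc (of_real (2/e)) ((s n - t n) - (s m - t m))"
      have "?q m \<in> C" if "m \<ge> N" for m
      proof -
        have "(s n - t n) - (s m - t m) \<in> dil C (e/2)"
          using N[OF n that] by (intro gauge_less[OF idx_abs_convex] span_diff[OF zsp zsp])
        then obtain c where "c \<in> C" "(s n - t n) - (s m - t m) = sc (of_real (e/2)) c" by blast
        then show ?thesis using e by simp
      qed
      then have "\<forall>\<^sub>F m in sequentially. ?q m \<in> C" unfolding eventually_sequentially by blast
      moreover have "?q \<longlonglongrightarrow> sc (of_real (2/e)) ((s n - t n) - 0)"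
        by (intro tendsto_sc tendsto_diff tendsto_const z0)
      ultimately have "sc (of_real (2/e)) (s n - t n) \<in> C"
        using Lim_in_closed_set[OF cl, of ?q sequentially "sc (of_real (2/e)) ((s n - t n) - 0)"]
        by simp
      moreover have "s n - t n = sc (of_real (e/2)) (sc (of_real (2/e)) (s n - t n))"
        using e by simp
      ultimately have "s n - t n \<in> dil C (e/2)" by (rule rev_image_eqI)
      then have "gauge_seminorm sc C (s n - t n) \<le> e/2" using e by (intro gauge_le[OF idx_abs_convex]) simp_all
      then show ?thesis using gauge_nonneg[OF idx_abs_convex zsp] e by simp
    qed
    then show "\<exists>N. \<forall>n\<ge>N. norm (gauge_seminorm sc C (s n - t n) - 0) < e" by blast
  qed
  then have "(s, t) \<in> null_rel (hull_space sc C)"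
    using s(1) t(1) by (intro H.null_relI) (simp_all add: vdist_hull_space)
  then show "X = Y" using s(2) t(2) H.cls_eq by simp
qed

end

lemma ev_trans_map:
  assumes C: "C \<in> idx (IB sc)" and D: "D \<in> idx (IB sc)" and CD: "C \<subseteq> D"
    and X: "X \<in> vcarrier (banach_of C)"
  shows "ev (trans_map (IB sc) C D X) = ev X"
proof -
  interpret h: seminormed_hom "hull_space sc C" "hull_space sc D" id 1
    using C D CD by (intro inclusion_hom) (simp_all add: idx_IB)
  obtain s where s: "s \<in> cauchy_seqs (hull_space sc C)" "X = cl C s"
    using h.V.carrier_completionE[OF X] .
  have "trans_map (IB sc) C D X = cl D (\<lambda>n. s n)"
    using h.completion_map_cls[OF s(1)] s(2) by (simp add: IB_def)
  then show ?thesis using ev_cls_eq[OF D] h.cauchy_image[OF s(1)] ev_cls_lim[OF C s(1)] s(2) by simp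
qed

end

section \<open>Banach spaces and their morphisms\<close>

text \<open>
  Density of a space in its completion: a Cauchy sequence, viewed termwise in the completion,
  converges to its own class.
\<close>

lemma (in seminormed_space) const_tendsto_completion:
  assumes s: "s \<in> cauchy_seqs V"
  shows "(\<lambda>n. vdist (hcompletion V) (cls (\<lambda>_. s n)) (cls s)) \<longlonglongrightarrow> 0"
proof (rule LIMSEQ_I)
  interpret K: seminormed_space "hcompletion V" by (rule seminormed_completion)
  have sc: "s n \<in> vcarrier V" for n by (rule cauchy_closed[OF s])
  fix e :: real assume e: "e > 0"
  obtain N where N: "\<And>m n. \<lbrakk>N \<le> m; N \<le> n\<rbrakk> \<Longrightarrow> vdist V (s m) (s n) < e/2"
    using cauchyE[OF s, of "e/2"] e by auto
  have "norm (vdist (hcompletion V) (cls (\<lambda>_. s n)) (cls s) - 0) < e" if n: "n \<ge> N" for n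
  proof -
    have "vdist (hcompletion V) (cls (\<lambda>_. s n)) (cls s) \<le> e/2"
      by (rule LIMSEQ_le_const2[OF completion_dist_lim[OF cauchy_const[OF sc] s]])
        (use N[OF n] in \<open>auto intro!: exI[of _ N] less_imp_le\<close>)
    moreover have "0 \<le> vdist (hcompletion V) (cls (\<lambda>_. s n)) (cls s)"
      by (intro K.dist_nonneg cls_closed cauchy_const sc s)
    ultimately show ?thesis using e by simp
  qed
  then show "\<exists>N. \<forall>n\<ge>N. norm (vdist (hcompletion V) (cls (\<lambda>_. s n)) (cls s) - 0) < e" by blast
qed

lemma ban_homD:
  assumes "u \<in> ban_hom V W"
  shows "x \<in> vcarrier V \<Longrightarrow> u x \<in> vcarrier W"
    and "\<lbrakk>x \<in> vcarrier V; y \<in> vcarrier V\<rbrakk> \<Longrightarrow> u (vadd V x y) = vadd W (u x) (u y)"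
    and "x \<in> vcarrier V \<Longrightarrow> u (vscale V c x) = vscale W c (u x)"
    and "u \<in> extensional (vcarrier V)"
  using assms by (auto simp: ban_hom_def PiE_def)

lemma ban_hom_contE:
  assumes "u \<in> ban_hom V W" "x \<in> vcarrier V" "e > 0"
  obtains d where "d > 0" "\<And>y. \<lbrakk>y \<in> vcarrier V; vdist V y x < d\<rbrakk> \<Longrightarrow> vdist W (u y) (u x) < e"
  using assms unfolding ban_hom_def by blast

lemma ban_homI:
  assumes "\<And>x. x \<in> vcarrier V \<Longrightarrow> u x \<in> vcarrier W"
    and "\<And>x y. \<lbrakk>x \<in> vcarrier V; y \<in> vcarrier V\<rbrakk> \<Longrightarrow> u (vadd V x y) = vadd W (u x) (u y)"
    and "\<And>c x. x \<in> vcarrier V \<Longrightarrow> u (vscale V c x) = vscale W c (u x)"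
    and "u \<in> extensional (vcarrier V)"
    and "\<And>x e. \<lbrakk>x \<in> vcarrier V; e > 0\<rbrakk> \<Longrightarrow>
      \<exists>d>0. \<forall>y\<in>vcarrier V. vdist V y x < d \<longrightarrow> vdist W (u y) (u x) < e"
  shows "u \<in> ban_hom V W"
  using assms unfolding ban_hom_def PiE_def by blast

lemma ban_hom_tendsto:
  assumes W: "seminormed_space W" and u: "u \<in> ban_hom V W"
    and s: "\<And>n. s n \<in> vcarrier V" and x: "x \<in> vcarrier V"
    and lim: "((\<lambda>n. vdist V (s n) x) \<longlongrightarrow> 0) F"
  shows "((\<lambda>n. vdist W (u (s n)) (u x)) \<longlongrightarrow> 0) F"
proof (rule tendstoI)
  interpret W: seminormed_space W by (rule W)
  fix e :: real assume "e > 0"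
  then obtain d where d: "d > 0" "\<And>y. \<lbrakk>y \<in> vcarrier V; vdist V y x < d\<rbrakk> \<Longrightarrow> vdist W (u y) (u x) < e"
    using ban_hom_contE[OF u x] by blast
  from order_tendstoD(2)[OF lim d(1)]
  show "\<forall>\<^sub>F n in F. dist (vdist W (u (s n)) (u x)) 0 < e"
    by (rule eventually_mono) (simp add: d(2) s abs_of_nonneg W.dist_nonneg ban_homD(1)[OF u] x)
qed

lemma compose_ban_hom:
  assumes t: "t \<in> ban_hom V W" and u: "u \<in> ban_hom W Z"
    and V: "seminormed_space V"
  shows "compose (vcarrier V) u t \<in> ban_hom V Z"
proof -
  interpret V: seminormed_space V by (rule V)
  show ?thesis
  proof (rule ban_homI)
    fix x and e :: real assume x: "x \<in> vcarrier V" and e: "e > 0"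
    obtain d where d: "d > 0" "\<And>y. \<lbrakk>y \<in> vcarrier W; vdist W y (t x) < d\<rbrakk> \<Longrightarrow> vdist Z (u y) (u (t x)) < e"
      using ban_hom_contE[OF u ban_homD(1)[OF t x] e] by blast
    obtain d' where "d' > 0" "\<And>y. \<lbrakk>y \<in> vcarrier V; vdist V y x < d'\<rbrakk> \<Longrightarrow> vdist W (t y) (t x) < d"
      using ban_hom_contE[OF t x d(1)] by blast
    then show "\<exists>d>0. \<forall>y\<in>vcarrier V. vdist V y x < d \<longrightarrow>
        vdist Z (compose (vcarrier V) u t y) (compose (vcarrier V) u t x) < e"
      using d(2) ban_homD(1)[OF t] x by (intro exI[of _ d']) (simp add: compose_eq)
  qed (simp_all add: compose_eq ban_homD[OF t] ban_homD[OF u] V.add_closed V.scale_closed)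
qed

lemma add_ban_hom:
  assumes u: "u \<in> ban_hom V W" and v: "v \<in> ban_hom V W"
    and V: "seminormed_space V" and W: "seminormed_space W"
  shows "(\<lambda>x\<in>vcarrier V. vadd W (u x) (v x)) \<in> ban_hom V W" (is "?w \<in> _")
proof -
  interpret V: seminormed_space V by (rule V)
  interpret W: seminormed_space W by (rule W)
  have c: "u x \<in> vcarrier W" "v x \<in> vcarrier W" if "x \<in> vcarrier V" for x
    using ban_homD(1)[OF u that] ban_homD(1)[OF v that] by simp_all
  show ?thesis
  proof (rule ban_homI)
    fix x and e :: real assume x: "x \<in> vcarrier V" and "e > 0"
    then have e: "e/2 > 0" by simp
    obtain d where d: "d > 0" "\<And>y. \<lbrakk>y \<in> vcarrier V; vdist V y x < d\<rbrakk> \<Longrightarrow> vdist W (u y) (u x) < e/2"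
      using ban_hom_contE[OF u x e] by blast
    obtain d' where d': "d' > 0" "\<And>y. \<lbrakk>y \<in> vcarrier V; vdist V y x < d'\<rbrakk> \<Longrightarrow> vdist W (v y) (v x) < e/2"
      using ban_hom_contE[OF v x e] by blast
    have "vdist W (?w y) (?w x) < e" if y: "y \<in> vcarrier V" "vdist V y x < min d d'" for y
      using W.dist_add[OF c[OF y(1)] c[OF x]] d(2)[of y] d'(2)[of y] x y by simp
    then show "\<exists>d>0. \<forall>y\<in>vcarrier V. vdist V y x < d \<longrightarrow> vdist W (?w y) (?w x) < e"
      using d(1) d'(1) by (intro exI[of _ "min d d'"]) simp
  qed (simp_all add: c ban_homD(2,3)[OF u] ban_homD(2,3)[OF v] V.add_closed V.scale_closed
      W.add_closed W.scale_closed W.add_assoc W.add_left_commute W.scale_add_right)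
qed

lemma scale_ban_hom:
  assumes u: "u \<in> ban_hom V W"
    and V: "seminormed_space V" and W: "seminormed_space W"
  shows "(\<lambda>x\<in>vcarrier V. vscale W a (u x)) \<in> ban_hom V W" (is "?w \<in> _")
proof -
  interpret V: seminormed_space V by (rule V)
  interpret W: seminormed_space W by (rule W)
  have c: "u x \<in> vcarrier W" if "x \<in> vcarrier V" for x
    using ban_homD(1)[OF u that] by simp
  show ?thesis
  proof (rule ban_homI)
    fix x and e :: real assume x: "x \<in> vcarrier V" and "e > 0"
    then have e: "e / (cmod a + 1) > 0" by (simp add: add_nonneg_pos)
    obtain d where d: "d > 0" "\<And>y. \<lbrakk>y \<in> vcarrier V; vdist V y x < d\<rbrakk> \<Longrightarrow>
        vdist W (u y) (u x) < e / (cmod a + 1)"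
      using ban_hom_contE[OF u x e] by blast
    have "vdist W (?w y) (?w x) < e" if y: "y \<in> vcarrier V" "vdist V y x < d" for y
    proof -
      have "vdist W (?w y) (?w x) = cmod a * vdist W (u y) (u x)"
        using W.dist_scale[OF c[OF y(1)] c[OF x]] x y by simp
      also have "\<dots> \<le> (cmod a + 1) * vdist W (u y) (u x)"
        by (intro mult_right_mono W.dist_nonneg c x y) simp
      also have "\<dots> < e" using d(2)[OF y] by (simp add: pos_less_divide_eq add_nonneg_pos mult.commute)
      finally show ?thesis .
    qed
    then show "\<exists>d>0. \<forall>y\<in>vcarrier V. vdist V y x < d \<longrightarrow> vdist W (?w y) (?w x) < e"
      using d(1) by blast
  qed (simp_all add: c ban_homD(2,3)[OF u] V.add_closed V.scale_closed
      W.scale_closed W.scale_add_right W.scale_scale mult.commute)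
qed

context lctvs
begin

lemma seminormed_hull: "B \<in> idx (IB sc) \<Longrightarrow> seminormed_space (hull_space sc B)"
  by (simp add: idx_IB seminormed_hull_space)

lemma seminormed_banach_of: "B \<in> idx (IB sc) \<Longrightarrow> seminormed_space (banach_of B)"
  by (simp add: seminormed_space.seminormed_completion seminormed_hull)

lemma banach_ofE:
  assumes "B \<in> idx (IB sc)" "X \<in> vcarrier (banach_of B)"
  obtains s where "s \<in> cauchy_seqs (hull_space sc B)" "X = cl B s"
  using seminormed_space.carrier_completionE[OF seminormed_hull[OF assms(1)] assms(2)] .

lemma const_cauchy:
  "\<lbrakk>B \<in> idx (IB sc); x \<in> span B\<rbrakk> \<Longrightarrow> (\<lambda>_. x) \<in> cauchy_seqs (hull_space sc B)"
  using seminormed_space.cauchy_const[OF seminormed_hull] by simp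

lemma cl_closed:
  "\<lbrakk>B \<in> idx (IB sc); s \<in> cauchy_seqs (hull_space sc B)\<rbrakk> \<Longrightarrow> cl B s \<in> vcarrier (banach_of B)"
  by (intro seminormed_space.cls_closed seminormed_hull)

lemma cauchy_mono:
  assumes "B \<in> idx (IB sc)" "C \<in> idx (IB sc)" "B \<subseteq> C" "s \<in> cauchy_seqs (hull_space sc B)"
  shows "s \<in> cauchy_seqs (hull_space sc C)"
proof -
  interpret h: seminormed_hom "hull_space sc B" "hull_space sc C" id 1
    using assms by (intro inclusion_hom) (simp_all add: idx_IB)
  show ?thesis using h.cauchy_image[OF assms(4)] by simp
qed

lemma trans_map_ban_hom:
  "\<lbrakk>B \<in> idx (IB sc); C \<in> idx (IB sc); B \<subseteq> C\<rbrakk> \<Longrightarrow>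
    trans_map (IB sc) B C \<in> ban_hom (banach_of B) (banach_of C)"
  using ind_banach.trans_hom[OF ind_banach_IB] by simp

lemma trans_map_cl:
  assumes "B \<in> idx (IB sc)" "C \<in> idx (IB sc)" "B \<subseteq> C" "s \<in> cauchy_seqs (hull_space sc B)"
  shows "trans_map (IB sc) B C (cl B s) = cl C s"
proof -
  interpret h: seminormed_hom "hull_space sc B" "hull_space sc C" id 1
    using assms by (intro inclusion_hom) (simp_all add: idx_IB)
  show ?thesis using h.completion_map_cls[OF assms(4)] by (simp add: IB_def)
qed

end

context complete_lctvs
begin

section \<open>Inductive limits of morphisms as maps into the space\<close>

definition realise :: "'v seminormed \<Rightarrow> 'a set \<times> ('v \<Rightarrow> (nat \<Rightarrow> 'a) set) \<Rightarrow> 'v \<Rightarrow> 'a"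
  where "realise V p = (\<lambda>x\<in>vcarrier V. ev (snd p x))"

abbreviation reps :: "'v seminormed \<Rightarrow> ('a set \<times> ('v \<Rightarrow> (nat \<Rightarrow> 'a) set)) set"
  where "reps V \<equiv> (SIGMA C:idx (IB sc). ban_hom V (banach_of C))"

definition germ :: "'v seminormed \<Rightarrow> 'a set \<times> ('v \<Rightarrow> (nat \<Rightarrow> 'a) set) \<Rightarrow>
    ('a set \<times> ('v \<Rightarrow> (nat \<Rightarrow> 'a) set)) set"
  where "germ V p = colim_rel V (IB sc) `` {p}"

lemma realise_eq_iff:
  "realise V p = realise V q \<longleftrightarrow> (\<forall>x\<in>vcarrier V. ev (snd p x) = ev (snd q x))"
  unfolding realise_def by (auto simp: fun_eq_iff restrict_def)

text \<open>
  Transition maps do not change values under \<open>ev\<close>, so equivalent representatives have the same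
  realisation.  Conversely, transport both representatives to a common closed index, where
  \<open>ev\<close> is injective.
\<close>

lemma colim_rel_iff:
  "(p, q) \<in> colim_rel V (IB sc) \<longleftrightarrow> p \<in> reps V \<and> q \<in> reps V \<and> realise V p = realise V q"
proof -
  obtain C u where p: "p = (C, u)" by force
  obtain D v where q: "q = (D, v)" by force
  show ?thesis
  proof (cases "p \<in> reps V \<and> q \<in> reps V")
    case True
    then have C: "C \<in> idx (IB sc)" "u \<in> ban_hom V (banach_of C)"
      and D: "D \<in> idx (IB sc)" "v \<in> ban_hom V (banach_of D)" by (auto simp: p q)
    have evC: "ev (trans_map (IB sc) C K (u x)) = ev (u x)"
      if "K \<in> idx (IB sc)" "C \<subseteq> K" "x \<in> vcarrier V" for K x
      by (intro ev_trans_map C that ban_homD(1)[OF C(2)])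
    have evD: "ev (trans_map (IB sc) D K (v x)) = ev (v x)"
      if "K \<in> idx (IB sc)" "D \<subseteq> K" "x \<in> vcarrier V" for K x
      by (intro ev_trans_map D that ban_homD(1)[OF D(2)])
    let ?eq = "\<lambda>K. compose (vcarrier V) (trans_map (IB sc) C K) u
        = compose (vcarrier V) (trans_map (IB sc) D K) v"
    have "(\<exists>K\<in>idx (IB sc). C \<subseteq> K \<and> D \<subseteq> K \<and> ?eq K) \<longleftrightarrow> (\<forall>x\<in>vcarrier V. ev (u x) = ev (v x))"
    proof
      assume "\<exists>K\<in>idx (IB sc). C \<subseteq> K \<and> D \<subseteq> K \<and> ?eq K"
      then obtain K where K: "K \<in> idx (IB sc)" "C \<subseteq> K" "D \<subseteq> K" "?eq K" by blast
      show "\<forall>x\<in>vcarrier V. ev (u x) = ev (v x)"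
      proof
        fix x assume x: "x \<in> vcarrier V"
        have "trans_map (IB sc) C K (u x) = trans_map (IB sc) D K (v x)"
          using fun_cong[OF K(4), of x] x by (simp add: compose_eq)
        then show "ev (u x) = ev (v x)" using evC[OF K(1,2) x] evD[OF K(1,3) x] by simp
      qed
    next
      assume ev_eq: "\<forall>x\<in>vcarrier V. ev (u x) = ev (v x)"
      obtain K where K: "K \<in> idx (IB sc)" "C \<subseteq> K" "D \<subseteq> K" "closed K"
        using upper_bound_closed[OF C(1) D(1)] .
      have "trans_map (IB sc) C K (u x) = trans_map (IB sc) D K (v x)" if x: "x \<in> vcarrier V" for x
      proof (rule inj_onD[OF ev_inj_on_closed[OF K(1,4)]])
        show "ev (trans_map (IB sc) C K (u x)) = ev (trans_map (IB sc) D K (v x))"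
          using evC[OF K(1,2) x] evD[OF K(1,3) x] ev_eq x by simp
        show "trans_map (IB sc) C K (u x) \<in> vcarrier (banach_of K)"
          by (intro ban_homD(1)[OF trans_map_ban_hom] ban_homD(1)[OF C(2)] C K x)
        show "trans_map (IB sc) D K (v x) \<in> vcarrier (banach_of K)"
          by (intro ban_homD(1)[OF trans_map_ban_hom] ban_homD(1)[OF D(2)] D K x)
      qed
      then have "?eq K" unfolding compose_def by (intro restrict_ext) simp
      with K show "\<exists>K\<in>idx (IB sc). C \<subseteq> K \<and> D \<subseteq> K \<and> ?eq K" by blast
    qed
    then show ?thesis using True C D by (auto simp: colim_rel_def p q realise_eq_iff)
  next
    case False
    then show ?thesis by (auto simp: colim_rel_def)
  qed
qed

lemma mem_germ: "p \<in> reps V \<Longrightarrow> q \<in> germ V p \<longleftrightarrow> q \<in> reps V \<and> realise V q = realise V p"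
  unfolding germ_def by (auto simp: colim_rel_iff)

lemma germ_eq_iff: 
  assumes "p \<in> reps V" "q \<in> reps V"
  shows "germ V p = germ V q \<longleftrightarrow> (\<forall>x\<in>vcarrier V. ev (snd p x) = ev (snd q x))"
  unfolding realise_eq_iff[symmetric] using mem_germ[OF assms(1)] mem_germ[OF assms(2)] assms
  by (metis subsetI subset_antisym)

lemma colim_hom_IB: "colim_hom V (IB sc) = germ V ` reps V"
  by (auto simp: colim_hom_def quotient_def germ_def)

text \<open>
  The operations on the inductive limit are unions over all representatives of a class; such a
  union is evaluated by checking that its members depend on the realisation only.
\<close>

lemma UN_germ:
  assumes p: "p \<in> reps V"
    and "\<And>q. \<lbrakk>q \<in> reps V; \<And>x. x \<in> vcarrier V \<Longrightarrow> ev (snd q x) = ev (snd p x)\<rbrakk> \<Longrightarrow> h q = H"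
  shows "(\<Union>q\<in>germ V p. h q) = H"
proof -
  have "h q = H" if "q \<in> germ V p" for q
    using that assms(2) unfolding mem_germ[OF p] realise_eq_iff by blast
  moreover have "p \<in> germ V p" by (simp add: mem_germ[OF p] p)
  ultimately show ?thesis by auto
qed

lemma colim_precomp_germ:
  assumes V: "seminormed_space V" and t: "t \<in> ban_hom V W"
    and p: "p \<in> reps W" and r: "r \<in> reps V"
    and eq: "\<And>x. x \<in> vcarrier V \<Longrightarrow> ev (snd r x) = ev (snd p (t x))"
  shows "colim_precomp V (IB sc) t (germ W p) = germ V r"
  unfolding colim_precomp_def
proof (rule UN_germ[OF p])
  fix q assume q: "q \<in> reps W" and qp: "\<And>y. y \<in> vcarrier W \<Longrightarrow> ev (snd q y) = ev (snd p y)"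
  obtain C u where Cu: "q = (C, u)" by force
  have C: "C \<in> idx (IB sc)" and u: "u \<in> ban_hom W (banach_of C)" using q by (auto simp: Cu)
  have "germ V (C, compose (vcarrier V) u t) = germ V r"
    using C compose_ban_hom[OF t u V] ban_homD(1)[OF t] qp eq
    by (subst germ_eq_iff[OF _ r]) (auto simp: Cu compose_eq)
  then show "(case q of (j, u) \<Rightarrow> colim_rel V (IB sc) `` {(j, compose (vcarrier V) u t)}) = germ V r"
    by (simp add: Cu germ_def)
qed

lemma colim_scale_germ:
  assumes V: "seminormed_space V" and p: "p \<in> reps V" and r: "r \<in> reps V"
    and eq: "\<And>x. x \<in> vcarrier V \<Longrightarrow> ev (snd r x) = sc a (ev (snd p x))"
  shows "colim_scale V (IB sc) a (germ V p) = germ V r"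
  unfolding colim_scale_def
proof (rule UN_germ[OF p])
  fix q assume q: "q \<in> reps V" and qp: "\<And>y. y \<in> vcarrier V \<Longrightarrow> ev (snd q y) = ev (snd p y)"
  obtain C u where Cu: "q = (C, u)" by force
  have C: "C \<in> idx (IB sc)" and u: "u \<in> ban_hom V (banach_of C)" using q by (auto simp: Cu)
  have "germ V (C, \<lambda>x\<in>vcarrier V. vscale (banach_of C) a (u x)) = germ V r"
    using C scale_ban_hom[OF u V seminormed_banach_of[OF C]] ban_homD(1)[OF u] qp eq
    by (subst germ_eq_iff[OF _ r]) (auto simp: Cu ev_scale)
  then show "(case q of (j, u) \<Rightarrow>
      colim_rel V (IB sc) `` {(j, \<lambda>x\<in>vcarrier V. vscale (obj (IB sc) j) a (u x))}) = germ V r"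
    by (simp add: Cu germ_def)
qed

lemma colim_add_germ:
  assumes V: "seminormed_space V" and p: "p \<in> reps V" and q: "q \<in> reps V" and r: "r \<in> reps V"
    and eq: "\<And>x. x \<in> vcarrier V \<Longrightarrow> ev (snd r x) = ev (snd p x) + ev (snd q x)"
  shows "colim_add V (IB sc) (germ V p) (germ V q) = germ V r"
  unfolding colim_add_def
proof (rule UN_germ[OF p], unfold case_prod_beta', rule UN_germ[OF q])
  fix p' q' assume p': "p' \<in> reps V" and q': "q' \<in> reps V"
    and pp: "\<And>y. y \<in> vcarrier V \<Longrightarrow> ev (snd p' y) = ev (snd p y)"
    and qq: "\<And>y. y \<in> vcarrier V \<Longrightarrow> ev (snd q' y) = ev (snd q y)"
  let ?w = "\<lambda>k. \<lambda>x\<in>vcarrier V. vadd (obj (IB sc) k)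
      (trans_map (IB sc) (fst p') k (snd p' x)) (trans_map (IB sc) (fst q') k (snd q' x))"
  let ?K = "{k \<in> idx (IB sc). leq (IB sc) (fst p') k \<and> leq (IB sc) (fst q') k}"
  have P: "fst p' \<in> idx (IB sc)" "snd p' \<in> ban_hom V (banach_of (fst p'))"
    and Q: "fst q' \<in> idx (IB sc)" "snd q' \<in> ban_hom V (banach_of (fst q'))"
    using p' q' by auto
  have "colim_rel V (IB sc) `` {(k, ?w k)} = germ V r" if "k \<in> ?K" for k
  proof -
    have k: "k \<in> idx (IB sc)" "fst p' \<subseteq> k" "fst q' \<subseteq> k" using that by auto
    let ?u = "compose (vcarrier V) (trans_map (IB sc) (fst p') k) (snd p')"
    let ?v = "compose (vcarrier V) (trans_map (IB sc) (fst q') k) (snd q')"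
    have u: "?u \<in> ban_hom V (banach_of k)" and v: "?v \<in> ban_hom V (banach_of k)"
      by (rule compose_ban_hom[OF P(2) trans_map_ban_hom[OF P(1) k(1,2)] V],
          rule compose_ban_hom[OF Q(2) trans_map_ban_hom[OF Q(1) k(1,3)] V])
    have w: "?w k = (\<lambda>x\<in>vcarrier V. vadd (banach_of k) (?u x) (?v x))"
      by (intro restrict_ext) (simp add: compose_eq)
    have wr: "(k, ?w k) \<in> reps V"
      unfolding w using k(1) add_ban_hom[OF u v V seminormed_banach_of[OF k(1)]] by simp
    have "ev (?w k x) = ev (snd r x)" if x: "x \<in> vcarrier V" for x
    proof -
      have c: "snd p' x \<in> vcarrier (banach_of (fst p'))" "snd q' x \<in> vcarrier (banach_of (fst q'))"
        using ban_homD(1)[OF P(2) x] ban_homD(1)[OF Q(2) x] by simp_all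
      have "ev (?w k x) = ev (?u x) + ev (?v x)"
        unfolding w using x ev_add[OF k(1) ban_homD(1)[OF u x] ban_homD(1)[OF v x]] by simp
      then show ?thesis
        using x ev_trans_map[OF P(1) k(1,2) c(1)] ev_trans_map[OF Q(1) k(1,3) c(2)]
        by (simp add: compose_eq pp qq eq)
    qed
    then have "germ V (k, ?w k) = germ V r" by (subst germ_eq_iff[OF wr r]) simp
    then show ?thesis by (simp add: germ_def)
  qed
  moreover have "?K \<noteq> {}" using ind_banach.directed[OF ind_banach_IB P(1) Q(1)] by blast
  ultimately show "(\<Union>k\<in>?K. colim_rel V (IB sc) `` {(k, ?w k)}) = germ V r" by auto
qed

end

section \<open>The component maps of IB\<close>

text \<open>
  The preimage of an absolutely convex neighbourhood under a linear map that preserves bounded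
  sets is absolutely convex and absorbs all bounded sets.
\<close>

lemma bornological_continuous:
  assumes E: "lctvs sE" and F: "lctvs sF" and born: "bornological sE"
    and lin: "Vector_Spaces.linear sE sF f"
    and bdd: "\<And>B. B \<in> idx (IB sE) \<Longrightarrow> tvs_bounded sF (f ` B)"
  shows "continuous_on UNIV f"
proof -
  interpret E: lctvs sE by (rule E)
  interpret F: lctvs sF by (rule F)
  interpret f: Vector_Spaces.linear sE sF f by (rule lin)
  have preimage: "nhd0 (f -` V)" if V: "nhd0 V" "abs_convex sF V" for V
  proof -
    have ac: "abs_convex sE (f -` V)"
      unfolding abs_convex_def
    proof (intro conjI ballI allI impI)
      show "f -` V \<noteq> {}" using F.zero_in_abs_convex[OF V(2)] f.zero by (metis empty_iff vimageI)
    qed (simp add: f.add f.scale F.abs_convexD[OF V(2)])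
    have "absorbs sE (f -` V) A" if A: "tvs_bounded sE A" for A
    proof -
      obtain B where B: "B \<in> idx (IB sE)" "A \<subseteq> B" using E.bounded_subset_idx[OF A] .
      obtain r where r: "r > 0" "f ` B \<subseteq> sF (of_real r) ` V"
        using bdd[OF B(1)] V unfolding F.bounded_iff_abs_convex by blast
      have "A \<subseteq> sE (of_real r) ` (f -` V)"
      proof
        fix x assume "x \<in> A"
        then obtain v where v: "v \<in> V" "f x = sF (of_real r) v" using B(2) r(2) by blast
        then have "sE (of_real (1/r)) x \<in> f -` V" using r(1) by (simp add: f.scale)
        moreover have "x = sE (of_real r) (sE (of_real (1/r)) x)" using r(1) by simp
        ultimately show "x \<in> sE (of_real r) ` (f -` V)" by (rule rev_image_eqI)
      qed
      then show ?thesis unfolding E.absorbs_iff_abs_convex[OF ac] using r(1) by blast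
    qed
    then show ?thesis using born ac unfolding bornological_def by blast
  qed
  have "(f \<longlongrightarrow> f x) (at x)" for x
    unfolding F.tendsto_iff_abs_convex
  proof (intro allI impI, elim conjE)
    fix V assume V: "nhd0 V" "abs_convex sF V"
    have "\<forall>\<^sub>F y in at x. y - x \<in> f -` V"
      using preimage[OF V] iffD1[OF tendsto_iff_nhd0 tendsto_ident_at] by blast
    then show "\<forall>\<^sub>F y in at x. f y - f x \<in> V" by (rule eventually_mono) (simp add: f.diff)
  qed
  then show ?thesis by (simp add: continuous_on_def)
qed

locale tc_pair = E: lctvs sE + F: complete_lctvs sF
  for sE :: "complex \<Rightarrow> 'a::topological_ab_group_add \<Rightarrow> 'a"
    and sF :: "complex \<Rightarrow> 'b::topological_ab_group_add \<Rightarrow> 'b"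
begin

lemma tc_homD:
  assumes "f \<in> tc_hom sE sF"
  shows "Vector_Spaces.linear sE sF f" "f (x + y) = f x + f y" "f (sE c x) = sF c (f x)"
    "s \<longlonglongrightarrow> l \<Longrightarrow> (\<lambda>n. f (s n)) \<longlonglongrightarrow> f l"
proof -
  show lin: "Vector_Spaces.linear sE sF f" using assms by (simp add: tc_hom_def)
  interpret f: Vector_Spaces.linear sE sF f by (rule lin)
  show "f (x + y) = f x + f y" "f (sE c x) = sF c (f x)" by (rule f.add f.scale)+
  show "(\<lambda>n. f (s n)) \<longlonglongrightarrow> f l" if "s \<longlonglongrightarrow> l"
    using assms that continuous_on_tendsto_compose[of UNIV f s l] by (simp add: tc_hom_def)
qed

lemma linearI:
  assumes "\<And>x y. f (x + y) = f x + f y" "\<And>c x. f (sE c x) = sF c (f x)"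
  shows "Vector_Spaces.linear sE sF f"
  by unfold_locales (simp_all add: assms)

lemma tc_hom_add:
  assumes f: "f \<in> tc_hom sE sF" and g: "g \<in> tc_hom sE sF"
  shows "(\<lambda>x. f x + g x) \<in> tc_hom sE sF"
proof -
  have "Vector_Spaces.linear sE sF (\<lambda>x. f x + g x)"
    by (rule linearI) (simp_all add: tc_homD[OF f] tc_homD[OF g] F.scale_right_distrib algebra_simps)
  then show ?thesis using f g by (simp add: tc_hom_def continuous_on_add)
qed

lemma tc_hom_scale:
  assumes f: "f \<in> tc_hom sE sF"
  shows "(\<lambda>x. sF c (f x)) \<in> tc_hom sE sF"
proof -
  have "Vector_Spaces.linear sE sF (\<lambda>x. sF c (f x))"
    by (rule linearI) (simp_all add: tc_homD[OF f] F.scale_right_distrib mult.commute)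
  moreover have "continuous_on UNIV (\<lambda>x. sF c (f x))"
    using f continuous_on_compose2[OF F.continuous_on_sc, of UNIV f] by (simp add: tc_hom_def)
  ultimately show ?thesis by (simp add: tc_hom_def)
qed

context
  fixes f B assumes f: "f \<in> tc_hom sE sF" and B: "B \<in> idx (IB sE)"
begin

lemma image_idx: "f ` B \<in> idx (IB sF)"
proof -
  interpret f: Vector_Spaces.linear sE sF f by (rule tc_homD(1)[OF f])
  have Bc: "abs_convex sE B" "tvs_bounded sE B" using B by (simp_all add: E.idx_IB)
  have "abs_convex sF (f ` B)"
    unfolding abs_convex_def
  proof (intro conjI ballI allI impI)
    show "f ` B \<noteq> {}" using Bc by (simp add: abs_convex_def)
    fix x y a b assume "x \<in> f ` B" "y \<in> f ` B" and ab: "cmod a + cmod b \<le> 1"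
    then obtain x' y' where xy: "x' \<in> B" "x = f x'" "y' \<in> B" "y = f y'" by blast
    have "sF a x + sF b y = f (sE a x' + sE b y')" using xy by (simp add: f.add f.scale)
    then show "sF a x + sF b y \<in> f ` B"
      using E.abs_convexD[OF Bc(1) xy(1,3) ab] by (rule image_eqI)
  qed
  moreover have "tvs_bounded sF (f ` B)"
    unfolding tvs_bounded_def
  proof (intro allI impI)
    fix U :: "'b set" assume U: "nhd0 U"
    have "(f \<longlongrightarrow> f 0) (nhds 0)"
      using f continuous_on_tendsto_compose[OF _ filterlim_ident, of UNIV f 0] by (simp add: tc_hom_def)
    then have "nhd0 (f -` U)" using U unfolding tendsto_iff_nhd0 f.zero by (simp add: nhd0_def)
    then obtain r where r: "r > 0" "\<And>c. r \<le> cmod c \<Longrightarrow> B \<subseteq> sE c ` (f -` U)"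
      using Bc(2) unfolding tvs_bounded_def absorbs_def by blast
    have "f ` B \<subseteq> sF c ` U" if c: "r \<le> cmod c" for c
    proof
      fix y assume "y \<in> f ` B"
      then obtain x where "x \<in> f -` U" "y = f (sE c x)" using r(2)[OF c] by blast
      then show "y \<in> sF c ` U" by (auto simp: f.scale)
    qed
    then show "absorbs sF U (f ` B)" unfolding absorbs_def using r(1) by blast
  qed
  ultimately show ?thesis by (simp add: F.idx_IB)
qed

lemma image_seminormed_hom: "seminormed_hom (hull_space sE B) (hull_space sF (f ` B)) f 1"
proof (intro seminormed_hom.intro seminormed_hom_axioms.intro E.seminormed_hull F.seminormed_hull
    B image_idx)
  interpret f: Vector_Spaces.linear sE sF f by (rule tc_homD(1)[OF f])
  have Bc: "abs_convex sE B" using B by (simp add: E.idx_IB)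
  have fBc: "abs_convex sF (f ` B)" using image_idx by (simp add: F.idx_IB)
  fix x assume "x \<in> vcarrier (hull_space sE B)"
  then have x: "x \<in> E.span B" by simp
  have dil: "f x \<in> F.dil (f ` B) t" if xt: "x \<in> E.dil B t" for t
  proof -
    obtain b where b: "b \<in> B" "x = sE (of_real t) b" using xt by blast
    have "f x = sF (of_real t) (f b)" by (simp add: b(2) f.scale)
    then show ?thesis using b(1) by blast
  qed
  obtain t where "t > 0" "x \<in> E.dil B t" using x unfolding E.span_abs_convex[OF Bc] by blast
  then show "f x \<in> vcarrier (hull_space sF (f ` B))"
    using dil unfolding F.hull_space_simps F.span_abs_convex[OF fBc] by blast
  have "gauge_seminorm sF (f ` B) (f x) \<le> gauge_seminorm sE B x"
  proof (rule dense_ge)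
    fix t assume t: "gauge_seminorm sE B x < t"
    then have "0 < t" using E.gauge_nonneg[OF Bc x] by simp
    then show "gauge_seminorm sF (f ` B) (f x) \<le> t"
      using F.gauge_le[OF fBc _ dil[OF E.gauge_less[OF Bc x t]]] by simp
  qed
  then show "vnorm (hull_space sF (f ` B)) (f x) \<le> 1 * vnorm (hull_space sE B) x" by simp
qed (simp_all add: tc_homD[OF f])

definition IB_rep where "IB_rep = (f ` B, completion_map (hull_space sE B) (hull_space sF (f ` B)) f)"

lemma IB_rep_reps: "IB_rep \<in> F.reps (E.banach_of B)"
  using seminormed_hom.completion_map_hom[OF image_seminormed_hom] image_idx by (simp add: IB_rep_def)

lemma IB_map_germ: "IB_map sE sF f B = F.germ (E.banach_of B) IB_rep"
  using B by (simp add: IB_map_def F.germ_def IB_rep_def)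

text \<open>
  The realisation of a component of \<open>IB f\<close> is the extension of \<open>f\<close> by continuity.  All
  identities between such components are deduced from this by uniqueness of limits.
\<close>

lemma ev_IB_rep_lim:
  assumes s: "s \<in> cauchy_seqs (hull_space sE B)"
  shows "(\<lambda>n. f (s n)) \<longlonglongrightarrow> F.ev (snd IB_rep (E.cl B s))"
  using F.ev_cls_lim[OF image_idx seminormed_hom.cauchy_image[OF image_seminormed_hom s]]
  by (simp add: IB_rep_def seminormed_hom.completion_map_cls[OF image_seminormed_hom s])

lemma ev_IB_rep_eq:
  "\<lbrakk>s \<in> cauchy_seqs (hull_space sE B); (\<lambda>n. f (s n)) \<longlonglongrightarrow> l\<rbrakk> \<Longrightarrow> F.ev (snd IB_rep (E.cl B s)) = l"
  using F.lim_unique[OF ev_IB_rep_lim] by simp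

end

lemma IB_map_in_ind_hom:
  assumes f: "f \<in> tc_hom sE sF"
  shows "IB_map sE sF f \<in> ind_hom (IB sE) (IB sF)"
  unfolding ind_hom_def
proof (intro CollectI conjI ballI impI)
  show "IB_map sE sF f \<in> (\<Pi>\<^sub>E i\<in>idx (IB sE). colim_hom (obj (IB sE) i) (IB sF))"
  proof (rule PiE_I)
    fix B assume B: "B \<in> idx (IB sE)"
    show "IB_map sE sF f B \<in> colim_hom (obj (IB sE) B) (IB sF)"
      using IB_map_germ[OF f B] IB_rep_reps[OF f B] by (simp add: F.colim_hom_IB)
  qed (simp add: IB_map_def)
next
  fix B C assume B: "B \<in> idx (IB sE)" and C: "C \<in> idx (IB sE)" and "leq (IB sE) B C"
  then have BC: "B \<subseteq> C" by simp
  have "colim_precomp (E.banach_of B) (IB sF) (trans_map (IB sE) B C) (F.germ (E.banach_of C) (IB_rep f C))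
      = F.germ (E.banach_of B) (IB_rep f B)"
  proof (rule F.colim_precomp_germ[OF E.seminormed_banach_of[OF B] E.trans_map_ban_hom[OF B C BC]
        IB_rep_reps[OF f C] IB_rep_reps[OF f B]])
    fix X assume "X \<in> vcarrier (E.banach_of B)"
    then obtain s where s: "s \<in> cauchy_seqs (hull_space sE B)" "X = E.cl B s" using E.banach_ofE[OF B] by blast
    show "F.ev (snd (IB_rep f B) X) = F.ev (snd (IB_rep f C) (trans_map (IB sE) B C X))"
      using ev_IB_rep_eq[OF f B s(1) ev_IB_rep_lim[OF f C E.cauchy_mono[OF B C BC s(1)]]] s(2)
      by (simp add: E.trans_map_cl[OF B C BC s(1)])
  qed
  then show "IB_map sE sF f B = colim_precomp (obj (IB sE) B) (IB sF) (trans_map (IB sE) B C) (IB_map sE sF f C)"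
    by (simp add: IB_map_germ[OF f B] IB_map_germ[OF f C])
qed

lemma IB_map_add:
  assumes f: "f \<in> tc_hom sE sF" and g: "g \<in> tc_hom sE sF"
  shows "IB_map sE sF (\<lambda>x. f x + g x) =
    ind_hom_add (IB sE) (IB sF) (IB_map sE sF f) (IB_map sE sF g)"
proof
  fix B
  note h = tc_hom_add[OF f g]
  show "IB_map sE sF (\<lambda>x. f x + g x) B =
    ind_hom_add (IB sE) (IB sF) (IB_map sE sF f) (IB_map sE sF g) B"
  proof (cases "B \<in> idx (IB sE)")
    case B: True
    have "colim_add (E.banach_of B) (IB sF) (F.germ (E.banach_of B) (IB_rep f B))
        (F.germ (E.banach_of B) (IB_rep g B)) = F.germ (E.banach_of B) (IB_rep (\<lambda>x. f x + g x) B)"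
    proof (rule F.colim_add_germ[OF E.seminormed_banach_of[OF B] IB_rep_reps[OF f B]
          IB_rep_reps[OF g B] IB_rep_reps[OF h B]])
      fix X assume "X \<in> vcarrier (E.banach_of B)"
      then obtain s where s: "s \<in> cauchy_seqs (hull_space sE B)" "X = E.cl B s" using E.banach_ofE[OF B] by blast
      show "F.ev (snd (IB_rep (\<lambda>x. f x + g x) B) X) = F.ev (snd (IB_rep f B) X) + F.ev (snd (IB_rep g B) X)"
        unfolding s(2)
        by (intro ev_IB_rep_eq[OF h B s(1)] tendsto_add ev_IB_rep_lim f g B s(1))
    qed
    then show ?thesis using B
      by (simp add: ind_hom_add_def IB_map_germ[OF f B] IB_map_germ[OF g B] IB_map_germ[OF h B])
  qed (simp add: ind_hom_add_def IB_map_def)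
qed

lemma IB_map_scale:
  assumes f: "f \<in> tc_hom sE sF"
  shows "IB_map sE sF (\<lambda>x. sF c (f x)) = ind_hom_scale (IB sE) (IB sF) c (IB_map sE sF f)"
proof
  fix B
  note h = tc_hom_scale[OF f, of c]
  show "IB_map sE sF (\<lambda>x. sF c (f x)) B = ind_hom_scale (IB sE) (IB sF) c (IB_map sE sF f) B"
  proof (cases "B \<in> idx (IB sE)")
    case B: True
    have "colim_scale (E.banach_of B) (IB sF) c (F.germ (E.banach_of B) (IB_rep f B))
        = F.germ (E.banach_of B) (IB_rep (\<lambda>x. sF c (f x)) B)"
    proof (rule F.colim_scale_germ[OF E.seminormed_banach_of[OF B] IB_rep_reps[OF f B] IB_rep_reps[OF h B]])
      fix X assume "X \<in> vcarrier (E.banach_of B)"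
      then obtain s where s: "s \<in> cauchy_seqs (hull_space sE B)" "X = E.cl B s" using E.banach_ofE[OF B] by blast
      show "F.ev (snd (IB_rep (\<lambda>x. sF c (f x)) B) X) = sF c (F.ev (snd (IB_rep f B) X))"
        unfolding s(2)
        by (intro ev_IB_rep_eq[OF h B s(1)] F.tendsto_sc ev_IB_rep_lim f B s(1))
    qed
    then show ?thesis using B
      by (simp add: ind_hom_scale_def IB_map_germ[OF f B] IB_map_germ[OF h B])
  qed (simp add: ind_hom_scale_def IB_map_def)
qed

lemma ev_IB_rep_const:
  assumes f: "f \<in> tc_hom sE sF" and B: "B \<in> idx (IB sE)" and x: "x \<in> E.span B"
  shows "F.ev (snd (IB_rep f B) (E.cl B (\<lambda>_. x))) = f x"
  by (rule ev_IB_rep_eq[OF f B E.const_cauchy[OF B x]]) simp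

section \<open>Injectivity and surjectivity\<close>

lemma IB_map_inj: "inj_on (IB_map sE sF) (tc_hom sE sF)"
proof (rule inj_onI, rule ext)
  fix f g x assume f: "f \<in> tc_hom sE sF" and g: "g \<in> tc_hom sE sF" and eq: "IB_map sE sF f = IB_map sE sF g"
  obtain B where B: "B \<in> idx (IB sE)" "x \<in> B" using E.point_in_idx .
  have x: "x \<in> E.span B" using B(2) by (rule E.span_base)
  have "F.germ (E.banach_of B) (IB_rep f B) = F.germ (E.banach_of B) (IB_rep g B)"
    using eq IB_map_germ[OF f B(1)] IB_map_germ[OF g B(1)] by simp
  then have "F.ev (snd (IB_rep f B) (E.cl B (\<lambda>_. x))) = F.ev (snd (IB_rep g B) (E.cl B (\<lambda>_. x)))"
    unfolding F.germ_eq_iff[OF IB_rep_reps[OF f B(1)] IB_rep_reps[OF g B(1)]]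
    using E.cl_closed[OF B(1) E.const_cauchy[OF B(1) x]] by blast
  then show "f x = g x" by (simp add: ev_IB_rep_const f g B(1) x)
qed

context
  fixes B C u
  assumes B: "B \<in> idx (IB sE)" and C: "C \<in> idx (IB sF)"
    and u: "u \<in> ban_hom (E.banach_of B) (F.banach_of C)"
begin

interpretation H: seminormed_space "hull_space sE B" by (rule E.seminormed_hull[OF B])
interpretation K: seminormed_space "E.banach_of B" by (rule E.seminormed_banach_of[OF B])
interpretation W: seminormed_space "F.banach_of C" by (rule F.seminormed_banach_of[OF C])

text \<open>
  The linear map on the hull of \<open>B\<close> underlying a morphism between completed hulls; it determines
  the realisation of \<open>u\<close> by density (\<open>hull_restriction_lim\<close>) and maps \<open>B\<close> to a bounded set by
  continuity of \<open>u\<close> at zero (\<open>hull_restriction_bounded\<close>).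
\<close>

definition hull_restriction :: "'a \<Rightarrow> 'b" where "hull_restriction x = F.ev (u (E.cl B (\<lambda>_. x)))"

lemma const_closed: "x \<in> E.span B \<Longrightarrow> E.cl B (\<lambda>_. x) \<in> vcarrier (E.banach_of B)"
  by (rule E.cl_closed[OF B E.const_cauchy[OF B]])

lemma hull_restriction_add:
  assumes x: "x \<in> E.span B" and y: "y \<in> E.span B"
  shows "hull_restriction (x + y) = hull_restriction x + hull_restriction y"
proof -
  have "E.cl B (\<lambda>_. x + y) = vadd (E.banach_of B) (E.cl B (\<lambda>_. x)) (E.cl B (\<lambda>_. y))"
    using H.completion_add[OF E.const_cauchy[OF B x] E.const_cauchy[OF B y]] by simp
  then show ?thesis
    using F.ev_add[OF C ban_homD(1)[OF u const_closed[OF x]] ban_homD(1)[OF u const_closed[OF y]]]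
    by (simp add: hull_restriction_def ban_homD(2)[OF u] const_closed x y)
qed

lemma hull_restriction_scale:
  assumes x: "x \<in> E.span B"
  shows "hull_restriction (sE c x) = sF c (hull_restriction x)"
proof -
  have "E.cl B (\<lambda>_. sE c x) = vscale (E.banach_of B) c (E.cl B (\<lambda>_. x))"
    using H.completion_scale[OF E.const_cauchy[OF B x]] by simp
  then show ?thesis
    using F.ev_scale[OF C ban_homD(1)[OF u const_closed[OF x]]]
    by (simp add: hull_restriction_def ban_homD(3)[OF u] const_closed x)
qed

lemma hull_restriction_lim:
  assumes s: "s \<in> cauchy_seqs (hull_space sE B)"
  shows "(\<lambda>n. hull_restriction (s n)) \<longlonglongrightarrow> F.ev (u (E.cl B s))"
  unfolding hull_restriction_def
proof (rule F.ev_tendsto[OF C])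
  have sp: "s n \<in> E.span B" for n using H.cauchy_closed[OF s] by simp
  show "u (E.cl B (\<lambda>_. s n)) \<in> vcarrier (F.banach_of C)" for n by (intro ban_homD(1)[OF u] const_closed sp)
  show "u (E.cl B s) \<in> vcarrier (F.banach_of C)" by (intro ban_homD(1)[OF u] E.cl_closed[OF B] s)
  show "(\<lambda>n. vdist (F.banach_of C) (u (E.cl B (\<lambda>_. s n))) (u (E.cl B s))) \<longlonglongrightarrow> 0"
    by (rule ban_hom_tendsto[OF F.seminormed_banach_of[OF C] u _ _ H.const_tendsto_completion[OF s]])
      (intro const_closed sp E.cl_closed[OF B] s)+
qed

lemma hull_restriction_bounded: "tvs_bounded sF (hull_restriction ` B)"
proof -
  have zero: "u (vzero (E.banach_of B)) = vzero (F.banach_of C)"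
    using ban_homD(3)[OF u K.zero_closed, of 0]
    by (simp add: K.scale_zero[OF K.zero_closed] W.scale_zero[OF ban_homD(1)[OF u K.zero_closed]])
  obtain d where d: "d > 0" "\<And>X. \<lbrakk>X \<in> vcarrier (E.banach_of B); vdist (E.banach_of B) X (vzero (E.banach_of B)) < d\<rbrakk>
      \<Longrightarrow> vdist (F.banach_of C) (u X) (u (vzero (E.banach_of B))) < 1"
    using ban_hom_contE[OF u K.zero_closed zero_less_one] by blast
  have Bc: "abs_convex sE B" using B by (simp add: E.idx_IB)
  \<comment> \<open>Multiplication by \<open>d/2\<close> rather than \<open>d\<close> puts \<open>B\<close> strictly inside the ball of radius \<open>d\<close>.\<close>
  have small: "hull_restriction (sE (of_real (d/2)) b) \<in> closure C" if b: "b \<in> B" for b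
  proof -
    have x: "sE (of_real (d/2)) b \<in> E.span B" using b by (intro E.span_scale E.span_base)
    let ?X = "E.cl B (\<lambda>_. sE (of_real (d/2)) b)"
    have "gauge_seminorm sE B (sE (of_real (d/2)) b) \<le> d/2"
      using d(1) b by (intro E.gauge_le[OF Bc]) simp_all
    moreover have "vnorm (E.banach_of B) ?X = gauge_seminorm sE B (sE (of_real (d/2)) b)"
      by (rule H.completion_norm[OF E.const_cauchy[OF B x]]) simp
    ultimately have "vnorm (E.banach_of B) ?X < d" using d(1) by simp
    then have "vdist (E.banach_of B) ?X (vzero (E.banach_of B)) < d"
      by (simp only: K.dist_zero[OF const_closed[OF x]])
    then have "vdist (F.banach_of C) (u ?X) (vzero (F.banach_of C)) < 1"
      using d(2)[OF const_closed[OF x]] unfolding zero by blast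
    then have "vnorm (F.banach_of C) (u ?X) < 1"
      by (simp only: W.dist_zero[OF ban_homD(1)[OF u const_closed[OF x]]])
    then show ?thesis unfolding hull_restriction_def
      by (rule F.ev_unit_ball[OF C ban_homD(1)[OF u const_closed[OF x]]])
  qed
  have bd: "tvs_bounded sF (closure C)" using C by (simp add: F.idx_IB F.closure_bounded)
  show ?thesis
    unfolding F.bounded_iff_abs_convex
  proof (intro allI impI, elim conjE)
    fix V assume V: "nhd0 V" "abs_convex sF V"
    obtain r where r: "r > 0" "closure C \<subseteq> sF (of_real r) ` V"
      using bd V unfolding F.bounded_iff_abs_convex by blast
    have "hull_restriction b \<in> sF (of_real (2*r/d)) ` V" if b: "b \<in> B" for b
    proof -
      obtain v where v: "v \<in> V" "hull_restriction (sE (of_real (d/2)) b) = sF (of_real r) v"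
        using small[OF b] r(2) by blast
      have "sF (of_real (d/2)) (hull_restriction b) = sF (of_real r) v"
        using v(2) hull_restriction_scale[OF E.span_base[OF b]] by simp
      then have "sF (of_real (2/d)) (sF (of_real (d/2)) (hull_restriction b)) = sF (of_real (2/d)) (sF (of_real r) v)"
        by (rule arg_cong)
      then have "hull_restriction b = sF (of_real (2*r/d)) v" using d(1) by simp
      then show ?thesis using v(1) by (rule image_eqI)
    qed
    then show "\<exists>r>0. hull_restriction ` B \<subseteq> sF (of_real r) ` V"
      using r(1) d(1) by (intro exI[of _ "2*r/d"]) auto
  qed
qed

end

text \<open>
  The hull restrictions of representatives of the components of \<open>\<phi>\<close> agree on smaller hulls, so
  they glue to a linear map \<open>f\<close>.
\<close>

lemma IB_map_surj:
  assumes born: "bornological sE" and \<phi>: "\<phi> \<in> ind_hom (IB sE) (IB sF)"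
  obtains f where "f \<in> tc_hom sE sF" "IB_map sE sF f = \<phi>"
proof -
  have \<phi>_ext: "\<phi> \<in> (\<Pi>\<^sub>E B\<in>idx (IB sE). colim_hom (E.banach_of B) (IB sF))"
    and \<phi>_compat: "\<And>B C. \<lbrakk>B \<in> idx (IB sE); C \<in> idx (IB sE); B \<subseteq> C\<rbrakk> \<Longrightarrow>
      \<phi> B = colim_precomp (E.banach_of B) (IB sF) (trans_map (IB sE) B C) (\<phi> C)"
    using \<phi> unfolding ind_hom_def mem_Collect_eq E.obj_IB E.leq_IB by blast+
  have "\<exists>q. q \<in> F.reps (E.banach_of B) \<and> \<phi> B = F.germ (E.banach_of B) q" if "B \<in> idx (IB sE)" for B
  proof -
    have "\<phi> B \<in> F.germ (E.banach_of B) ` F.reps (E.banach_of B)"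
      using PiE_mem[OF \<phi>_ext that] unfolding F.colim_hom_IB .
    then show ?thesis by blast
  qed
  then have "\<forall>B. \<exists>q. B \<in> idx (IB sE) \<longrightarrow> q \<in> F.reps (E.banach_of B) \<and> \<phi> B = F.germ (E.banach_of B) q"
    by blast
  from choice[OF this] obtain p where p': "\<forall>B. B \<in> idx (IB sE) \<longrightarrow>
      p B \<in> F.reps (E.banach_of B) \<and> \<phi> B = F.germ (E.banach_of B) (p B)" ..
  have p: "p B \<in> F.reps (E.banach_of B)" "\<phi> B = F.germ (E.banach_of B) (p B)"
    if "B \<in> idx (IB sE)" for B using p'[rule_format, OF that] by (rule conjunct1, rule conjunct2)
  have pC: "fst (p B) \<in> idx (IB sF)" and pu: "snd (p B) \<in> ban_hom (E.banach_of B) (F.banach_of (fst (p B)))"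
    if "B \<in> idx (IB sE)" for B using p(1)[OF that] by auto
  define g where "g B = hull_restriction B (snd (p B))" for B
  \<comment> \<open>Compare the realisations of the two sides of the compatibility condition at a constant sequence.\<close>
  have compat: "g B x = g C x"
    if B: "B \<in> idx (IB sE)" and C: "C \<in> idx (IB sE)" and BC: "B \<subseteq> C" and x: "x \<in> E.span B" for B C x
  proof -
    let ?t = "trans_map (IB sE) B C"
    let ?X = "E.cl B (\<lambda>_. x)"
    let ?r = "(fst (p C), compose (vcarrier (E.banach_of B)) (snd (p C)) ?t)"
    have r: "?r \<in> F.reps (E.banach_of B)"
      using pC[OF C] compose_ban_hom[OF E.trans_map_ban_hom[OF B C BC] pu[OF C] E.seminormed_banach_of[OF B]]
      by simp
    have X: "?X \<in> vcarrier (E.banach_of B)" by (rule E.cl_closed[OF B E.const_cauchy[OF B x]])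
    have "\<phi> B = colim_precomp (E.banach_of B) (IB sF) ?t (\<phi> C)"
      by (rule \<phi>_compat[OF B C BC])
    also have "\<dots> = F.germ (E.banach_of B) ?r"
      unfolding p(2)[OF C]
      by (rule F.colim_precomp_germ[OF E.seminormed_banach_of[OF B] E.trans_map_ban_hom[OF B C BC] p(1)[OF C] r])
        (simp add: compose_eq)
    finally have "F.ev (snd (p B) ?X) = F.ev (snd ?r ?X)"
      using X unfolding p(2)[OF B] F.germ_eq_iff[OF p(1)[OF B] r] by blast
    then show ?thesis
      using X E.trans_map_cl[OF B C BC E.const_cauchy[OF B x]]
      by (simp add: g_def hull_restriction_def[OF B pC[OF B] pu[OF B]] hull_restriction_def[OF C pC[OF C] pu[OF C]] compose_eq)
  qed
  have "\<forall>x. \<exists>B. B \<in> idx (IB sE) \<and> x \<in> B" using E.point_in_idx by metis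
  then obtain b where b: "\<And>x. b x \<in> idx (IB sE)" "\<And>x. x \<in> b x" by metis
  \<comment> \<open>The bounded set \<open>b x\<close> is an arbitrary choice; directedness of the indices makes it immaterial.\<close>
  define f where "f x = g (b x) x" for x
  have fg: "f x = g B x" if B: "B \<in> idx (IB sE)" and x: "x \<in> E.span B" for B x
  proof -
    obtain D where D: "D \<in> idx (IB sE)" "B \<subseteq> D" "b x \<subseteq> D" using E.upper_bound_closed[OF B b(1)] .
    show ?thesis unfolding f_def
      using compat[OF b(1) D(1,3) E.span_base[OF b(2)]] compat[OF B D(1,2) x] by simp
  qed
  have lin: "Vector_Spaces.linear sE sF f"
  proof (rule linearI)
    fix x y
    obtain D where D: "D \<in> idx (IB sE)" "b x \<subseteq> D" "b y \<subseteq> D" using E.upper_bound_closed[OF b(1) b(1)] .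
    have xy: "x \<in> E.span D" "y \<in> E.span D" using D b(2) by (blast intro: E.span_base)+
    show "f (x + y) = f x + f y"
      using hull_restriction_add[OF D(1) pC[OF D(1)] pu[OF D(1)] xy] fg[OF D(1)] xy E.span_add
      by (simp add: g_def)
    show "f (sE c x) = sF c (f x)" for c
      using hull_restriction_scale[OF D(1) pC[OF D(1)] pu[OF D(1)] xy(1)] fg[OF D(1)] xy E.span_scale
      by (simp add: g_def)
  qed
  have "tvs_bounded sF (f ` B)" if B: "B \<in> idx (IB sE)" for B
  proof -
    have "f ` B = g B ` B" using fg[OF B E.span_base] by (rule image_cong[OF refl])
    then show ?thesis using hull_restriction_bounded[OF B pC[OF B] pu[OF B]] by (simp add: g_def)
  qed
  then have "continuous_on UNIV f"
    by (rule bornological_continuous[OF E.lctvs_axioms F.lctvs_axioms born lin])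
  then have f: "f \<in> tc_hom sE sF" using lin by (simp add: tc_hom_def)
  have "IB_map sE sF f B = \<phi> B" for B
  proof (cases "B \<in> idx (IB sE)")
    case B: True
    have "F.ev (snd (IB_rep f B) X) = F.ev (snd (p B) X)" if X: "X \<in> vcarrier (E.banach_of B)" for X
    proof -
      obtain s where s: "s \<in> cauchy_seqs (hull_space sE B)" "X = E.cl B s" using E.banach_ofE[OF B X] .
      have "s n \<in> E.span B" for n
        using seminormed_space.cauchy_closed[OF E.seminormed_hull[OF B] s(1)] by simp
      then have "(\<lambda>n. f (s n)) = (\<lambda>n. hull_restriction B (snd (p B)) (s n))" using fg[OF B] by (simp add: g_def)
      then show ?thesis
        using ev_IB_rep_eq[OF f B s(1)] hull_restriction_lim[OF B pC[OF B] pu[OF B] s(1)] s(2) by simp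
    qed
    then show ?thesis
      unfolding IB_map_germ[OF f B] p(2)[OF B] by (subst F.germ_eq_iff[OF IB_rep_reps[OF f B] p(1)[OF B]]) blast
  next
    case False
    then show ?thesis using PiE_arb[OF \<phi>_ext] by (simp add: IB_map_def)
  qed
  then show ?thesis using that f by blast
qed

end

theorem proposition1p5:
  fixes sE :: "complex \<Rightarrow> 'a::topological_ab_group_add \<Rightarrow> 'a"
    and sF :: "complex \<Rightarrow> 'b::topological_ab_group_add \<Rightarrow> 'b"
  assumes "lctvs sE" and "lctvs sF"
    and "bornological sE" and "tvs_complete TYPE('b)"
  shows "bij_betw (IB_map sE sF) (tc_hom sE sF) (ind_hom (IB sE) (IB sF))
    \<and> (\<forall>f\<in>tc_hom sE sF. \<forall>g\<in>tc_hom sE sF.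
        IB_map sE sF (\<lambda>x. f x + g x) =
          ind_hom_add (IB sE) (IB sF) (IB_map sE sF f) (IB_map sE sF g))
    \<and> (\<forall>c. \<forall>f\<in>tc_hom sE sF.
        IB_map sE sF (\<lambda>x. sF c (f x)) = ind_hom_scale (IB sE) (IB sF) c (IB_map sE sF f))"
proof -
  interpret tc_pair sE sF
    using assms by (simp add: tc_pair_def complete_lctvs_def complete_lctvs_axioms_def)
  have "IB_map sE sF ` tc_hom sE sF = ind_hom (IB sE) (IB sF)"
  proof (rule set_eqI, rule iffI)
    fix \<phi> assume "\<phi> \<in> ind_hom (IB sE) (IB sF)"
    then show "\<phi> \<in> IB_map sE sF ` tc_hom sE sF"
      by (rule IB_map_surj[OF assms(3)]) blast
  qed (use IB_map_in_ind_hom in blast)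
  then have "bij_betw (IB_map sE sF) (tc_hom sE sF) (ind_hom (IB sE) (IB sF))"
    using IB_map_inj by (simp add: bij_betw_def)
  then show ?thesis using IB_map_add IB_map_scale by blast
qed

end
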